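(* For any $\epsilon,\delta>0$ and any distribution $\mathcal{D}$ over fair cost-sharing games with $N$ agents and action set $\mathcal{A}$ (with action costs at most $H$), $O\!\left(\frac{|\mathcal{A}|^2H^2}{\epsilon^2}\left(|\mathcal{A}|\log(|\mathcal{A}|N)+\log\frac1\delta\right)\right)$ games drawn i.i.d. from $\mathcal{D}$ suffice to ensure that, with probability at least $1-\delta$ over the draw, the subsidy vector minimizing the average loss $L_{\mathrm{prior}}$ over the sample has expected loss over $\mathcal{D}$ at most $\epsilon$ larger than the expected loss of the best subsidy vector over $\mathcal{D}$.
   Context: Fair cost-sharing game: agents $[N]$, finite action set $\mathcal{A}$, map $f:\mathcal{A}\to2^{[N]}$ (agent $i$ may use action $a$ iff $i\in f(a)$), and (prior expected) action costs $c(a)\le H$. In a joint action $s$, each of the $k$ agents using action $a$ pays $c(a)/k$. A subsidy scheme is a vector $c^{\mathbb{S}}:\mathcal{A}\to[0,H]$; each agent using action $a$ (with $k$ users) receives $c^{\mathbb{S}}(a)/k$, subtracted from its cost. Let $\mathrm{cost}^{\mathbb{S}}(s)$ be the subsidized social cost, $\mathrm{subs}(s)$ the total subsidy paid at $s$, and $\mathcal{S}_{NE}(\mathbb{S})$ the set of pure Nash equilibria of the subsidized game. The loss is $L_{\mathrm{prior}}(\mathbb{S})=\max_{s\in\mathcal{S}_{NE}(\mathbb{S})}\mathrm{cost}^{\mathbb{S}}(s)+\mathrm{subs}(s)$ (at most $2H|\mathcal{A}|$). *)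

theory Defs
  imports "HOL-Probability.Probability"
begin

text \<open>A fair cost-sharing game over agents 0..<N and a finite action set Act of naturals:
  the pair (f, c), where f a is the set of agents allowed to use action a and c a is its cost.\<close>
type_synonym game = "(nat \<Rightarrow> nat set) \<times> (nat \<Rightarrow> real)"

definition valid_game :: "nat \<Rightarrow> nat set \<Rightarrow> real \<Rightarrow> game \<Rightarrow> bool" where
  "valid_game N Act H g \<longleftrightarrow> (\<forall>a\<in>Act. fst g a \<subseteq> {0..<N} \<and> 0 \<le> snd g a \<and> snd g a \<le> H)"

definition joint_actions :: "nat \<Rightarrow> nat set \<Rightarrow> game \<Rightarrow> (nat \<Rightarrow> nat) set" where
  "joint_actions N Act g = {s \<in> {0..<N} \<rightarrow>\<^sub>E Act. \<forall>i<N. i \<in> fst g (s i)}"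

definition users :: "nat \<Rightarrow> (nat \<Rightarrow> nat) \<Rightarrow> nat \<Rightarrow> nat set" where
  "users N s a = {i \<in> {0..<N}. s i = a}"

definition agent_cost :: "nat \<Rightarrow> game \<Rightarrow> (nat \<Rightarrow> real) \<Rightarrow> (nat \<Rightarrow> nat) \<Rightarrow> nat \<Rightarrow> real" where
  "agent_cost N g cS s i = (snd g (s i) - cS (s i)) / real (card (users N s (s i)))"

definition is_NE :: "nat \<Rightarrow> nat set \<Rightarrow> game \<Rightarrow> (nat \<Rightarrow> real) \<Rightarrow> (nat \<Rightarrow> nat) \<Rightarrow> bool" where
  "is_NE N Act g cS s \<longleftrightarrow> s \<in> joint_actions N Act g \<and>
     (\<forall>i<N. \<forall>b\<in>Act. i \<in> fst g b \<longrightarrow> agent_cost N g cS s i \<le> agent_cost N g cS (s(i := b)) i)"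

definition sub_cost :: "nat \<Rightarrow> game \<Rightarrow> (nat \<Rightarrow> real) \<Rightarrow> (nat \<Rightarrow> nat) \<Rightarrow> real" where
  "sub_cost N g cS s = (\<Sum>i<N. agent_cost N g cS s i)"

definition subs :: "nat \<Rightarrow> (nat \<Rightarrow> real) \<Rightarrow> (nat \<Rightarrow> nat) \<Rightarrow> real" where
  "subs N cS s = (\<Sum>i<N. cS (s i) / real (card (users N s (s i))))"

text \<open>L_prior; convention 0 if there is no pure NE (cannot happen when joint actions exist).\<close>
definition loss_prior :: "nat \<Rightarrow> nat set \<Rightarrow> game \<Rightarrow> (nat \<Rightarrow> real) \<Rightarrow> real" where
  "loss_prior N Act g cS =
     (if {s. is_NE N Act g cS s} = {} then 0
      else Max ((\<lambda>s. sub_cost N g cS s + subs N cS s) ` {s. is_NE N Act g cS s}))"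

definition subsidies :: "nat set \<Rightarrow> real \<Rightarrow> (nat \<Rightarrow> real) set" where
  "subsidies Act H = Act \<rightarrow>\<^sub>E {0..H}"

definition exp_loss :: "nat \<Rightarrow> nat set \<Rightarrow> game measure \<Rightarrow> (nat \<Rightarrow> real) \<Rightarrow> real" where
  "exp_loss N Act D cS = (\<integral>g. loss_prior N Act g cS \<partial>D)"

definition emp_loss :: "nat \<Rightarrow> nat set \<Rightarrow> nat \<Rightarrow> (nat \<Rightarrow> game) \<Rightarrow> (nat \<Rightarrow> real) \<Rightarrow> real" where
  "emp_loss N Act m x cS = (\<Sum>i<m. loss_prior N Act (x i) cS) / real m"

end

theory Submission
  imports Defs
begin

text \<open>
  Subsidies cancel in the sum of subsidized cost and subsidy payments, so the loss depends on them
  only through the set of equilibria, which is determined by the comparisons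
  \<open>(c a - cS a) / k \<le> (c b - cS b) / l\<close>. For \<open>k\<close> games these are \<open>k |A|\<^sup>2 N\<^sup>2\<close> affine inequalities
  in \<open>|A|\<close> unknowns, so the loss vectors on \<open>k\<close> games take at most \<open>(2 k |A|\<^sup>2 N\<^sup>2)\<^bsup>|A|\<^esup>\<close> values.

  A union bound over these values would cost an extra factor \<open>log (1 / \<epsilon>)\<close>. It is avoided by
  chaining: after symmetrization with a ghost sample the deviation is a random signed sum, and the
  loss vectors are approximated by nets of Hamming radius \<open>m / 4\<^sup>j\<close>. Subsampling coordinates
  bounds the logarithm of the net size by a multiple of \<open>(j + 1) |A| log (|A| N)\<close>, so the Hoeffding
  bounds for the links between consecutive nets sum up geometrically.
\<close>

text \<open>The net sizes do not depend on the sample size \<open>m\<close>: the chance that a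
  random coordinate tells two vectors apart is their normalized Hamming distance, so the number of
  coordinates needed to tell apart all points of a net depends only on \<open>j\<close> and on the
  size of the net. For entries in [-1, 1], Hamming radius \<open>m / 4^j\<close> means Euclidean
  radius of order \<open>sqrt m / 2^j\<close>, which is what Hoeffding bounds see. Measurability
  decides the shape of the deviation bound. The loss jumps as the subsidies vary, and a supremum
  over uncountably many vectors need not be measurable. The bound is therefore proved over a
  countable set and on one side only: expected loss at most empirical loss plus a margin.
  Semicontinuity carries exactly this side over to all vectors. The opposite side is needed for just
  one near-optimal vector, fixed before the sample is drawn, where Hoeffding's inequality
  suffices.\<close>

section \<open>Sign patterns of affine functions\<close>

text \<open>Induction over the functions, as in counting the cells of a hyperplane arrangement.
  Adding \<open>f0\<close> increases the count only by the old patterns that its hyperplane cuts,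
  and these are patterns of \<open>F\<close> inside that hyperplane, one dimension lower. With
  \<open>n = card F\<close> and \<open>d = card J\<close> the recursion closes by
  \<open>(n + 1)^d + (n + 1)^(d - 1) \<le> (n + 2)^d\<close>.\<close>

lemma card_halfspace_patterns_le:
  fixes a :: "'f \<Rightarrow> 'v \<Rightarrow> real" and b :: "'f \<Rightarrow> real"
  assumes "finite F" and "finite J"
  shows "card (range (\<lambda>x. {f \<in> F. 0 \<le> b f + (\<Sum>j\<in>J. a f j * x j)})) \<le> (card F + 1) ^ card J"
  using assms
proof (induction F arbitrary: J a b rule: finite_induct)
  case empty
  then show ?case by simp
next
  case (insert f0 F)
  define A where "A = (\<lambda>f x. b f + (\<Sum>j\<in>J. a f j * x j))"
  define P where "P = range (\<lambda>x. {f \<in> F. 0 \<le> A f x})"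
  define R where "R = range (\<lambda>x. {f \<in> insert f0 F. 0 \<le> A f x})"
  have finP: "finite P"
    by (rule finite_subset[of _ "Pow F"]) (use insert in \<open>auto simp: P_def\<close>)
  have finR: "finite R"
    by (rule finite_subset[of _ "Pow (insert f0 F)"]) (use insert in \<open>auto simp: R_def\<close>)
  have cardP: "card P \<le> (card F + 1) ^ card J"
    using insert.IH[OF insert.prems, of b a] by (simp add: P_def A_def)
  \<comment> \<open>A pattern of \<open>F\<close> that extends both without and with
    \<open>f0\<close> lies in \<open>U\<close> and in \<open>B'\<close>, so \<open>card R\<close>
    exceeds \<open>card (U \<union> B')\<close> by the number of split patterns.\<close>
  define U where "U = {T \<in> R. f0 \<notin> T}"
  define B where "B = {T \<in> R. f0 \<in> T}"
  define B' where "B' = (\<lambda>T. T - {f0}) ` B"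
  have U_sub: "U \<subseteq> P"
    using insert.hyps by (auto simp: U_def R_def P_def)
  have B'_sub: "B' \<subseteq> P"
  proof
    fix T assume "T \<in> B'"
    then obtain x where "T = {f \<in> insert f0 F. 0 \<le> A f x} - {f0}"
      by (auto simp: B'_def B_def R_def)
    hence "T = {f \<in> F. 0 \<le> A f x}"
      using insert.hyps by auto
    thus "T \<in> P" by (auto simp: P_def)
  qed
  have cardB: "card B' = card B"
    unfolding B'_def by (rule card_image) (auto simp: inj_on_def B_def)
  have finUB: "finite U" "finite B" "finite B'"
    using finR by (auto simp: U_def B_def B'_def)
  have "card R = card U + card B"
    using finUB by (subst card_Un_disjoint[symmetric]) (auto simp: U_def B_def intro: arg_cong[of _ _ card])
  also have "\<dots> = card (U \<union> B') + card (U \<inter> B')"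
    using card_Un_Int[OF finUB(1,3)] cardB by simp
  also have "\<dots> \<le> (card F + 1) ^ card J + card (U \<inter> B')"
    using card_mono[OF finP, of "U \<union> B'"] U_sub B'_sub cardP by simp
  finally have R1: "card R \<le> (card F + 1) ^ card J + card (U \<inter> B')" .

  \<comment> \<open>A pattern that the new halfspace splits is attained on its bounding hyperplane, because the
    points with a given pattern form a convex set.\<close>
  have split: "\<exists>z. A f0 z = 0 \<and> T = {f \<in> F. 0 \<le> A f z} \<and> (\<exists>j\<in>J. a f0 j \<noteq> 0)"
    if T: "T \<in> U \<inter> B'" for T
  proof -
    from T obtain x where x: "T = {f \<in> insert f0 F. 0 \<le> A f x}" "f0 \<notin> T"
      by (auto simp: U_def R_def)
    from T obtain y where y: "T = {f \<in> insert f0 F. 0 \<le> A f y} - {f0}" "0 \<le> A f0 y"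
      by (auto simp: B'_def B_def R_def)
    have x0: "A f0 x < 0" using x by auto
    have Tx: "f \<in> T \<longleftrightarrow> 0 \<le> A f x" if "f \<in> F" for f
      using that by (simp add: x(1))
    have Ty: "f \<in> T \<longleftrightarrow> 0 \<le> A f y" if "f \<in> F" for f
      using that insert.hyps by (auto simp: y(1))
    \<comment> \<open>The segment from \<open>x\<close> to \<open>y\<close> meets the hyperplane at
      parameter \<open>\<theta>\<close>. It may equal 1, since \<open>A f0 y\<close> may be 0, but
      it is positive, which keeps functions negative at both ends strictly negative at
      \<open>z\<close>.\<close>
    define \<theta> where "\<theta> = - A f0 x / (A f0 y - A f0 x)"
    have \<theta>: "0 < \<theta>" "\<theta> \<le> 1"
      using x0 y(2) by (auto simp: \<theta>_def field_simps)
    define z where "z = (\<lambda>j. (1 - \<theta>) * x j + \<theta> * y j)"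
    have Az: "A f z = (1 - \<theta>) * A f x + \<theta> * A f y" for f
      by (simp add: A_def z_def sum.distrib sum_distrib_left algebra_simps sum_subtractf)
    have "A f0 z = 0"
      unfolding Az \<theta>_def using x0 y(2) by (simp add: divide_simps)
    moreover have "T = {f \<in> F. 0 \<le> A f z}"
    proof -
      have "(0 \<le> A f z) = (f \<in> T)" if "f \<in> F" for f
      proof (cases "f \<in> T")
        case True
        hence "0 \<le> A f x" "0 \<le> A f y" using Tx[OF that] Ty[OF that] by auto
        thus ?thesis using True \<theta> by (simp add: Az)
      next
        case False
        hence *: "A f x < 0" "A f y < 0" using Tx[OF that] Ty[OF that] by auto
        have "(1 - \<theta>) * A f x \<le> 0" using * \<theta> by (simp add: mult_nonneg_nonpos)
        moreover have "\<theta> * A f y < 0" using * \<theta> by (simp add: mult_pos_neg)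
        ultimately have "A f z < 0" unfolding Az by linarith
        thus ?thesis using False by simp
      qed
      moreover have "T \<subseteq> F" using x(2) by (auto simp: x(1))
      ultimately show ?thesis by auto
    qed
    moreover have "\<exists>j\<in>J. a f0 j \<noteq> 0"
    proof (rule ccontr)
      assume "\<not> ?thesis"
      hence "A f0 x = A f0 y" by (simp add: A_def)
      thus False using x0 y(2) by simp
    qed
    ultimately show ?thesis by blast
  qed
  have "card R \<le> (card (insert f0 F) + 1) ^ card J"
  proof (cases "\<exists>j\<in>J. a f0 j \<noteq> 0")
    case False
    hence "U \<inter> B' = {}" using split by blast
    hence "card R \<le> (card F + 1) ^ card J" using R1 by simp
    also have "\<dots> \<le> (card (insert f0 F) + 1) ^ card J"
      using insert.hyps by (intro power_mono) auto
    finally show ?thesis .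
  next
    case True
    then obtain j0 where j0: "j0 \<in> J" "a f0 j0 \<noteq> 0" by auto
    define J' where "J' = J - {j0}"
    \<comment> \<open>Coefficients after the equation \<open>A f0 z = 0\<close> has been solved for
      \<open>z j0\<close> and substituted.\<close>
    define a' where "a' = (\<lambda>f j. a f j - a f j0 * a f0 j / a f0 j0)"
    define b' where "b' = (\<lambda>f. b f - a f j0 * b f0 / a f0 j0)"
    have finJ': "finite J'" using insert.prems by (simp add: J'_def)
    have cJ: "card J = Suc (card J')"
      unfolding J'_def by (rule card.remove[OF insert.prems j0(1)])
    have sumJ: "(\<Sum>j\<in>J. g j) = g j0 + (\<Sum>j\<in>J'. g j)" for g :: "'v \<Rightarrow> real"
      unfolding J'_def by (rule sum.remove[OF insert.prems j0(1)])
    have elim: "b' f + (\<Sum>j\<in>J'. a' f j * z j) = A f z" if "A f0 z = 0" for f z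
    proof -
      have "z j0 = - (b f0 + (\<Sum>j\<in>J'. a f0 j * z j)) / a f0 j0"
        using that j0(2) by (simp add: A_def sumJ field_simps)
      hence "A f z = b f + a f j0 * (- (b f0 + (\<Sum>j\<in>J'. a f0 j * z j)) / a f0 j0)
          + (\<Sum>j\<in>J'. a f j * z j)"
        by (simp add: A_def sumJ)
      also have "\<dots> = b' f + (\<Sum>j\<in>J'. a' f j * z j)"
        by (simp add: b'_def a'_def left_diff_distrib sum_subtractf sum_distrib_left
            sum_divide_distrib add_divide_distrib diff_divide_distrib algebra_simps)
      finally show ?thesis by simp
    qed
    have "U \<inter> B' \<subseteq> range (\<lambda>z. {f \<in> F. 0 \<le> b' f + (\<Sum>j\<in>J'. a' f j * z j)})"
    proof
      fix T assume "T \<in> U \<inter> B'"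
      then obtain z where z: "A f0 z = 0" "T = {f \<in> F. 0 \<le> A f z}"
        using split by blast
      thus "T \<in> range (\<lambda>z. {f \<in> F. 0 \<le> b' f + (\<Sum>j\<in>J'. a' f j * z j)})"
        using elim[OF z(1)] by (intro image_eqI[of _ _ z]) simp_all
    qed
    moreover have "finite (range (\<lambda>z. {f \<in> F. 0 \<le> b' f + (\<Sum>j\<in>J'. a' f j * z j)}))"
      by (rule finite_subset[of _ "Pow F"]) (use insert in auto)
    ultimately have "card (U \<inter> B') \<le> (card F + 1) ^ card J'"
      using insert.IH[OF finJ', of b' a'] by (meson card_mono le_trans)
    hence "card R \<le> (card F + 1) ^ card J' * (card F + 2)"
      using R1 by (simp add: cJ algebra_simps)
    also have "\<dots> \<le> (card F + 2) ^ card J' * (card F + 2)"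
      by (intro mult_right_mono power_mono) auto
    also have "\<dots> = (card (insert f0 F) + 1) ^ card J"
      using insert.hyps by (simp add: cJ)
    finally show ?thesis .
  qed
  thus ?case by (simp add: R_def A_def)
qed

section \<open>Chaining for random signs\<close>

text \<open>\<open>cosh\<close> is the moment generating function of a random sign. The auxiliary
  inequality with arguments \<open>2 * y\<close> and \<open>1 / 2\<close> gives the bound because
  \<open>exp y * cosh y = (1 + exp (2 * y)) / 2\<close>.\<close>

lemma cosh_le_exp_half_square:
  fixes x :: real
  shows "cosh x \<le> exp (x\<^sup>2 / 2)"
proof -
  have *: "cosh y \<le> exp (y\<^sup>2 / 2)" if "0 \<le> y" for y :: real
  proof -
    have "- (2 * y) * (1 / 2) + ln (1 + 1 / 2 * (exp (2 * y) - 1)) \<le> (2 * y)\<^sup>2 / 8"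
      by (rule Hoeffdings_lemma_aux) (use that in auto)
    hence "ln (1 + 1 / 2 * (exp (2 * y) - 1)) \<le> y + y\<^sup>2 / 2"
      by (simp add: power2_eq_square)
    moreover have pos: "0 < 1 + 1 / 2 * (exp (2 * y) - 1)"
      by (simp add: algebra_simps add_pos_pos)
    ultimately have "1 + 1 / 2 * (exp (2 * y) - 1) \<le> exp (y + y\<^sup>2 / 2)"
      by (metis exp_le_cancel_iff exp_ln)
    moreover have "1 + 1 / 2 * (exp (2 * y) - 1) = exp y * cosh y"
      by (simp add: cosh_def algebra_simps flip: exp_add)
    ultimately show ?thesis by (simp add: exp_add)
  qed
  show ?thesis
    using *[of x] *[of "-x"] by (cases "0 \<le> x") auto
qed

lemma card_sign_vectors: "card ({..<m} \<rightarrow>\<^sub>E {-1, 1::real}) = 2 ^ m"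
  by (simp add: card_PiE numeral_2_eq_2)

lemma finite_sign_vectors [simp]: "finite ({..<m::nat} \<rightarrow>\<^sub>E {-1, 1::real})"
  by (simp add: finite_PiE)

lemma card_signed_sum_gt_le:
  fixes v :: "nat \<Rightarrow> real"
  assumes "0 < t" and "(\<Sum>i<m. (v i)\<^sup>2) \<le> q" and "0 < q"
  shows "real (card {\<sigma> \<in> {..<m} \<rightarrow>\<^sub>E {-1, 1::real}. t < (\<Sum>i<m. \<sigma> i * v i)})
    \<le> 2 ^ m * exp (- t\<^sup>2 / (2 * q))"
proof -
  let ?S = "{..<m} \<rightarrow>\<^sub>E {-1, 1::real}"
  \<comment> \<open>The minimizer of the Chernoff exponent
    \<open>l\<^sup>2 / 2 * q - l * t\<close>.\<close>
  define l where "l = t / q"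
  have l: "0 < l" using assms by (simp add: l_def)
  let ?B = "{\<sigma> \<in> ?S. t < (\<Sum>i<m. \<sigma> i * v i)}"
  have "real (card ?B) * exp (l * t) = (\<Sum>\<sigma>\<in>?B. exp (l * t))"
    by simp
  also have "\<dots> \<le> (\<Sum>\<sigma>\<in>?B. exp (l * (\<Sum>i<m. \<sigma> i * v i)))"
    using l by (intro sum_mono) auto
  also have "\<dots> \<le> (\<Sum>\<sigma>\<in>?S. exp (l * (\<Sum>i<m. \<sigma> i * v i)))"
    by (intro sum_mono2) auto
  also have "\<dots> = (\<Sum>\<sigma>\<in>?S. \<Prod>i<m. exp (l * \<sigma> i * v i))"
    by (simp add: sum_distrib_left exp_sum mult.assoc)
  also have "\<dots> = (\<Prod>i<m. \<Sum>s\<in>{-1, 1::real}. exp (l * s * v i))"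
    by (subst prod_sum_PiE) auto
  also have "\<dots> = (\<Prod>i<m. 2 * cosh (l * v i))"
    by (intro prod.cong) (auto simp: cosh_def)
  also have "\<dots> \<le> (\<Prod>i<m. 2 * exp ((l * v i)\<^sup>2 / 2))"
    by (intro prod_mono) (auto intro: cosh_le_exp_half_square)
  also have "\<dots> = 2 ^ m * exp (l\<^sup>2 / 2 * (\<Sum>i<m. (v i)\<^sup>2))"
    by (simp add: prod.distrib exp_sum[symmetric] sum_distrib_left power_mult_distrib)
  also have "\<dots> \<le> 2 ^ m * exp (l\<^sup>2 / 2 * q)"
    using assms by (simp add: mult_left_mono)
  finally have "real (card ?B) \<le> 2 ^ m * exp (l\<^sup>2 / 2 * q) / exp (l * t)"
    by (simp add: field_simps)
  also have "\<dots> = 2 ^ m * exp (l\<^sup>2 / 2 * q - l * t)"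
    by (simp add: exp_diff)
  also have "l\<^sup>2 / 2 * q - l * t = - t\<^sup>2 / (2 * q)"
    using assms by (simp add: l_def field_simps power2_eq_square)
  finally show ?thesis .
qed

section \<open>Nets and packing numbers in the Hamming distance\<close>

definition hamming :: "nat \<Rightarrow> (nat \<Rightarrow> real) \<Rightarrow> (nat \<Rightarrow> real) \<Rightarrow> nat" where
  "hamming m u v = card {i \<in> {..<m}. u i \<noteq> v i}"

definition separated :: "nat \<Rightarrow> real \<Rightarrow> (nat \<Rightarrow> real) set \<Rightarrow> bool" where
  "separated m \<alpha> W \<longleftrightarrow> (\<forall>u\<in>W. \<forall>v\<in>W. u \<noteq> v \<longrightarrow> \<alpha> * real m \<le> real (hamming m u v))"

lemma hamming_commute: "hamming m u v = hamming m v u"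
  unfolding hamming_def by (rule arg_cong[of _ _ card]) auto

lemma hamming_self [simp]: "hamming m u u = 0"
  by (simp add: hamming_def)

text \<open>A maximal separated subset is a net, since a point far from all of its elements could be
  added to it.\<close>

lemma separated_net_exists:
  assumes "finite V" and "0 < \<alpha>" and "0 < m"
  obtains W where "W \<subseteq> V" and "separated m \<alpha> W"
    and "\<And>v. v \<in> V \<Longrightarrow> \<exists>w\<in>W. real (hamming m v w) < \<alpha> * real m"
proof -
  define \<S> where "\<S> = {W. W \<subseteq> V \<and> separated m \<alpha> W}"
  have "finite \<S>"
    using assms(1) by (simp add: \<S>_def)
  moreover have "{} \<in> \<S>"
    by (simp add: \<S>_def separated_def)
  hence "\<S> \<noteq> {}" by blast
  ultimately obtain W where "W \<in> \<S>" and "\<forall>W'\<in>\<S>. W \<subseteq> W' \<longrightarrow> W = W'"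
    using finite_has_maximal by metis
  hence W: "W \<subseteq> V" "separated m \<alpha> W"
    and max: "\<And>W'. W' \<subseteq> V \<Longrightarrow> separated m \<alpha> W' \<Longrightarrow> W \<subseteq> W' \<Longrightarrow> W = W'"
    by (auto simp: \<S>_def)
  show ?thesis
  proof (rule that)
    fix v assume v: "v \<in> V"
    show "\<exists>w\<in>W. real (hamming m v w) < \<alpha> * real m"
    proof (rule ccontr)
      assume far: "\<not> ?thesis"
      hence "separated m \<alpha> (insert v W)"
        using W by (auto simp: separated_def not_less hamming_commute)
      hence "W = insert v W"
        using W v by (intro max) auto
      hence "v \<in> W" by auto
      thus False using far assms by force
    qed
  qed (use W in auto)
qed

text \<open>
  A uniformly random choice of \<open>k\<close> coordinates separates all pairs of a well separated set,
  so the size of such a set is controlled by the number of its traces on \<open>k\<close> coordinates.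
\<close>
lemma separated_injective_sample:
  assumes "finite W" and sep: "separated m \<alpha> W" and "0 < \<alpha>" and "\<alpha> \<le> 1" and "0 < m"
    and k: "2 * ln (real (card W)) \<le> \<alpha> * real k" and W: "W \<noteq> {}"
  shows "\<exists>\<iota>\<in>{..<k} \<rightarrow>\<^sub>E {..<m}. inj_on (\<lambda>v. \<lambda>j\<in>{..<k}. v (\<iota> j)) W"
proof (rule ccontr)
  assume contra: "\<not> ?thesis"
  define P where "P = {(u, v) \<in> W \<times> W. u \<noteq> v}"
  define I where "I = {..<k} \<rightarrow>\<^sub>E {..<m}"
  define eqs where "eqs = (\<lambda>(u, v). {i \<in> {..<m}. u i = (v i :: real)})"
  have finP: "finite P"
    by (rule finite_subset[of _ "W \<times> W"]) (use assms in \<open>auto simp: P_def\<close>)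
  \<comment> \<open>If no sample is injective on \<open>W\<close>, each one draws all its
    coordinates from places where some fixed pair agrees. Counting these samples pair by pair gives
    \<open>1 \<le> card P * (1 - \<alpha>)^k\<close>.\<close>
  have "I \<subseteq> (\<Union>p\<in>P. {..<k} \<rightarrow>\<^sub>E eqs p)"
  proof
    fix \<iota> assume \<iota>: "\<iota> \<in> I"
    hence "\<not> inj_on (\<lambda>v. \<lambda>j\<in>{..<k}. v (\<iota> j)) W"
      using contra by (auto simp: I_def)
    then obtain u v where uv: "u \<in> W" "v \<in> W" "u \<noteq> v"
      and eq: "(\<lambda>j\<in>{..<k}. u (\<iota> j)) = (\<lambda>j\<in>{..<k}. v (\<iota> j))"
      by (auto simp: inj_on_def)
    have "u (\<iota> j) = v (\<iota> j)" if "j < k" for j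
      using fun_cong[OF eq, of j] that by simp
    hence "\<iota> \<in> {..<k} \<rightarrow>\<^sub>E eqs (u, v)"
      using \<iota> by (auto simp: I_def eqs_def PiE_iff)
    thus "\<iota> \<in> (\<Union>p\<in>P. {..<k} \<rightarrow>\<^sub>E eqs p)"
      using uv by (auto simp: P_def)
  qed
  hence "card I \<le> card (\<Union>p\<in>P. {..<k} \<rightarrow>\<^sub>E eqs p)"
    by (rule card_mono[rotated]) (use finP in \<open>auto intro!: finite_PiE simp: eqs_def\<close>)
  also have "\<dots> \<le> (\<Sum>p\<in>P. card ({..<k} \<rightarrow>\<^sub>E eqs p))"
    by (rule card_UN_le[OF finP])
  finally have "real (card I) \<le> (\<Sum>p\<in>P. real (card (eqs p)) ^ k)"
    by (simp add: card_PiE flip: of_nat_power of_nat_sum)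
  also have "\<dots> \<le> (\<Sum>p\<in>P. ((1 - \<alpha>) * real m) ^ k)"
  proof (intro sum_mono power_mono)
    fix p assume "p \<in> P"
    then obtain u v where p: "p = (u, v)" and uv: "u \<in> W" "v \<in> W" "u \<noteq> v"
      by (auto simp: P_def)
    have "card (eqs p) + hamming m u v = card ({i \<in> {..<m}. u i = v i} \<union> {i \<in> {..<m}. u i \<noteq> v i})"
      unfolding hamming_def p eqs_def by (subst card_Un_disjoint) auto
    also have "{i \<in> {..<m}. u i = v i} \<union> {i \<in> {..<m}. u i \<noteq> v i} = {..<m}"
      by auto
    finally have "card (eqs p) + hamming m u v = m" by simp
    moreover have "\<alpha> * real m \<le> real (hamming m u v)"
      using sep uv by (auto simp: separated_def)
    ultimately show "real (card (eqs p)) \<le> (1 - \<alpha>) * real m"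
      by (simp add: algebra_simps flip: of_nat_add)
  qed auto
  also have "\<dots> = real (card P) * (1 - \<alpha>) ^ k * real m ^ k"
    by (simp add: power_mult_distrib)
  finally have "1 \<le> real (card P) * (1 - \<alpha>) ^ k"
    using \<open>0 < m\<close> by (simp add: I_def card_PiE)
  also have "\<dots> \<le> real (card P) * exp (- \<alpha> * real k)"
  proof -
    have "(1 - \<alpha>) ^ k \<le> exp (- \<alpha>) ^ k"
      using assms exp_ge_add_one_self[of "-\<alpha>"] by (intro power_mono) auto
    thus ?thesis by (intro mult_left_mono) (auto simp: exp_of_nat_mult[symmetric] mult.commute)
  qed
  also have "\<dots> \<le> real (card P) * exp (- (2 * ln (real (card W))))"
    using k by (intro mult_left_mono) auto
  also have "exp (- (2 * ln (real (card W)))) = 1 / real (card W) ^ 2"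
    using W assms(1) by (simp add: exp_minus exp_double card_gt_0_iff field_simps)
  \<comment> \<open>The diagonal of \<open>W \<times> W\<close> is missing from \<open>P\<close>;
    this makes the inequality strict and yields the contradiction.\<close>
  also have "real (card P) * (1 / real (card W) ^ 2) < 1"
  proof -
    obtain w where "w \<in> W" using W by auto
    hence "P \<subset> W \<times> W" by (auto simp: P_def)
    hence "card P < card (W \<times> W)"
      using assms(1) by (intro psubset_card_mono) auto
    hence "real (card P) < real (card W) ^ 2"
      by (simp add: card_cartesian_product power2_eq_square flip: of_nat_mult)
    thus ?thesis by (simp add: divide_less_eq)
  qed
  finally show False by simp
qed

text \<open>Let \<open>l = ln (card W)\<close>. About \<open>2 * l * 4^j\<close> coordinates tell
  all elements of \<open>W\<close> apart, so \<open>l \<le> p * ln (2 * K * k)\<close> with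
  \<open>k\<close> of that order. On the right \<open>l\<close> occurs only under a logarithm, and
  solving for it eliminates \<open>k\<close>. The hypothesis \<open>p \<le> K\<close> lets
  \<open>ln p\<close> be absorbed by \<open>ln K\<close>.\<close>

lemma card_separated_le:
  assumes finW: "finite W" and sep: "separated m (1 / 4 ^ j) W" and "0 < m"
    and K: "2 \<le> K" and p: "1 \<le> p" "p \<le> K"
    and trace: "\<And>k \<iota>. 1 \<le> k \<Longrightarrow> \<iota> \<in> {..<k} \<rightarrow>\<^sub>E {..<m} \<Longrightarrow>
      card ((\<lambda>v. \<lambda>i\<in>{..<k}. v (\<iota> i)) ` W) \<le> (2 * K * k) ^ p"
  shows "real (card W) \<le> exp (12 * (real p * ln (real K)) * real (j + 1))"
proof (cases "1 \<le> ln (real (card W))")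
  case False
  have lnK: "ln 2 \<le> ln (real K)" using K by simp
  have "1 \<le> 12 * ln (2::real)" using ln2_ge_two_thirds by simp
  also have "\<dots> \<le> 12 * (real p * ln (real K)) * real (j + 1)"
  proof -
    have "ln 2 * 1 \<le> (real p * ln (real K)) * real (j + 1)"
      using lnK p K by (intro mult_mono order.trans[OF _ mult_mono[of 1 "real p" "ln 2" "ln (real K)"]]) auto
    thus ?thesis by simp
  qed
  finally have "ln (real (card W)) \<le> 12 * (real p * ln (real K)) * real (j + 1)"
    using False by simp
  thus ?thesis
    by (metis exp_ge_zero exp_le_cancel_iff exp_ln of_nat_0_less_iff of_nat_0 gr0I)
next
  case True
  define l where "l = ln (real (card W))"
  have l1: "1 \<le> l" using True by (simp add: l_def)
  \<comment> \<open>\<open>ln 0 = 0\<close> puts the empty set into the other case.\<close>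
  have W: "W \<noteq> {}" using True by auto
  have cW: "0 < card W" using W finW by (simp add: card_gt_0_iff)
  define k where "k = nat \<lceil>2 * l * 4 ^ j\<rceil>"
  have k_lower: "2 * l * 4 ^ j \<le> real k" unfolding k_def by linarith
  \<comment> \<open>Rounding up adds at most 1, which a third multiple of \<open>l * 4 ^ j\<close>
    pays for.\<close>
  have "1 \<le> l * 4 ^ j" using l1 by (metis mult_mono one_le_power one_le_numeral mult_1 zero_le_one order.trans zero_le_numeral)
  hence k_upper: "real k \<le> 3 * l * 4 ^ j" and k1: "1 \<le> k" 
    using k_lower unfolding k_def by linarith+
  have "2 * ln (real (card W)) \<le> 1 / 4 ^ j * real k"
    using k_lower by (simp add: l_def field_simps)
  then obtain \<iota> where \<iota>: "\<iota> \<in> {..<k} \<rightarrow>\<^sub>E {..<m}" "inj_on (\<lambda>v. \<lambda>i\<in>{..<k}. v (\<iota> i)) W"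
    using separated_injective_sample[OF finW sep _ _ \<open>0 < m\<close> _ W, of k] by auto
  have "card W = card ((\<lambda>v. \<lambda>i\<in>{..<k}. v (\<iota> i)) ` W)"
    using \<iota>(2) by (simp add: card_image)
  also have "\<dots> \<le> (2 * K * k) ^ p" using trace[OF k1 \<iota>(1)] .
  finally have "real (card W) \<le> real (2 * K * k) ^ p"
    by (metis of_nat_le_iff of_nat_power)
  hence "l \<le> ln (real (2 * K * k) ^ p)"
    using cW unfolding l_def by simp
  also have "\<dots> = real p * ln (real (2 * K * k))"
    using K k1 by (simp add: ln_realpow)
  also have "\<dots> \<le> real p * ln (6 * (real K * 4 ^ j * l))"
    using K k1 k_upper l1 by (intro mult_left_mono) (auto intro!: ln_mono simp: field_simps)
  also have "ln (6 * (real K * 4 ^ j * l)) = ln 6 + ln (real K) + j * ln 4 + ln l"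
    using K l1 by (simp add: ln_mult ln_realpow)
  \<comment> \<open>The tangent bound \<open>ln x \<le> x - 1\<close> is used at
    \<open>l / (2 * p)\<close>: multiplied by \<open>p\<close> it costs \<open>l / 2\<close>, which
    moves to the left-hand side.\<close>
  also have "ln l \<le> l / (2 * p) + ln 2 + ln (real K) - 1"
  proof -
    have "ln l = ln (l / (2 * p)) + ln (2 * p)"
      using l1 p by (simp add: ln_div)
    moreover have "ln (l / (2 * p)) \<le> l / (2 * p) - 1"
      using l1 p by (intro ln_le_minus_one) auto
    moreover have "ln (real (2 * p)) = ln 2 + ln (real p)"
      using p by (simp add: ln_mult)
    moreover have "ln (real p) \<le> ln (real K)" using p by simp
    ultimately show ?thesis by linarith
  qed
  finally have "l \<le> real p * (ln 6 + ln (real K) + j * ln 4 + (l / (2 * p) + ln 2 + ln (real K) - 1))"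
    by (simp add: mult_left_mono)
  also have "\<dots> = l / 2 + real p * (ln 6 + ln 2 + 2 * ln (real K) + j * ln 4 - 1)"
    using p by (simp add: field_simps)
  finally have "l \<le> 2 * real p * (ln 6 + ln 2 + 2 * ln (real K) + j * ln 4 - 1)"
    by simp
  also have "\<dots> \<le> 2 * real p * (6 * ln (real K) * (j + 1))"
  proof (intro mult_left_mono)
    have lnK: "ln 2 \<le> ln (real K)" using K by simp
    have "ln 6 + ln 2 = ln (12::real)" using ln_mult[of 6 "2::real"] by simp
    also have "\<dots> \<le> ln (2 ^ 4)" by simp
    also have "\<dots> = 4 * ln (2::real)" by (subst ln_realpow) auto
    finally have 1: "ln 6 + ln 2 \<le> 4 * ln (2::real)" .
    have "ln 4 = 2 * ln (2::real)" using ln_realpow[of 2 2] by simp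
    hence "real j * ln 4 \<le> real j * (6 * ln (real K))"
      using lnK ln2_ge_two_thirds by (intro mult_left_mono) auto
    moreover have "6 * ln (real K) * real (j + 1) = real j * (6 * ln (real K)) + 6 * ln (real K)"
      by (simp add: algebra_simps)
    ultimately show "ln 6 + ln 2 + 2 * ln (real K) + j * ln 4 - 1 \<le> 6 * ln (real K) * (j + 1)"
      using 1 lnK by linarith
  qed auto
  finally have "l \<le> 12 * (real p * ln (real K)) * real (j + 1)" by (simp add: mult_ac)
  thus ?thesis using cW unfolding l_def by (metis exp_ln exp_le_cancel_iff of_nat_0_less_iff)
qed

section \<open>Dyadic chaining along the nets\<close>

lemma sum_chaining_weights: "(\<Sum>j\<le>J. (real j + 1) / 2 ^ j) = 4 - (real J + 3) / 2 ^ J"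
  by (induction J) (auto simp: field_simps)

text \<open>The link at level \<open>j\<close> may deviate by
  \<open>\<tau> * (j + 1) / 2^j * m\<close>; these allowances sum to less than
  \<open>4 * \<tau> * m\<close>. A link has squared length at most \<open>16 * m / 4^j\<close>, so
  its Hoeffding exponent is \<open>m * \<tau>^2 / 32 * (j + 1)^2\<close>. This beats the entropy
  \<open>a * (j + 1)\<close> and leaves failure probability at most
  \<open>\<delta> / 2^(j + 1)\<close> for the level.\<close>

lemma card_sign_chaining_le:
  fixes a \<tau> \<delta> :: real
  assumes finV: "finite V" and m: "0 < m"
    and bdd: "\<And>v i. v \<in> V \<Longrightarrow> i < m \<Longrightarrow> \<bar>v i\<bar> \<le> 1"
    and pack: "\<And>j W. W \<subseteq> V \<Longrightarrow> separated m (1 / 4 ^ j) W \<Longrightarrow> real (card W) \<le> exp (a * real (j + 1))"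
    and \<delta>: "0 < \<delta>" "\<delta> \<le> 1" and \<tau>: "0 < \<tau>"
    and large: "a + ln (2 / \<delta>) \<le> real m * \<tau>\<^sup>2 / 32"
  shows "real (card {\<sigma> \<in> {..<m} \<rightarrow>\<^sub>E {-1, 1::real}. \<exists>v\<in>V. 4 * \<tau> * real m < (\<Sum>i<m. \<sigma> i * v i)})
    \<le> 2 ^ m * \<delta>"
proof -
  let ?S = "{..<m} \<rightarrow>\<^sub>E {-1, 1::real}"
  define ip where "ip = (\<lambda>(\<sigma>::nat \<Rightarrow> real) v. \<Sum>i<m. \<sigma> i * v i)"
  have "\<exists>W. W \<subseteq> V \<and> separated m (1 / 4 ^ j) W \<and>
      (\<forall>v\<in>V. \<exists>w\<in>W. real (hamming m v w) < 1 / 4 ^ j * real m)" for j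
    by (rule separated_net_exists[OF finV, of "1 / 4 ^ j" m]) (use m in auto)
  then obtain W where W: "\<And>j. W j \<subseteq> V" "\<And>j. separated m (1 / 4 ^ j) (W j)"
    and near: "\<And>j v. v \<in> V \<Longrightarrow> \<exists>w\<in>W j. real (hamming m v w) < 1 / 4 ^ j * real m"
    by metis
  define \<pi> where "\<pi> = (\<lambda>j v. SOME w. w \<in> W j \<and> real (hamming m v w) < 1 / 4 ^ j * real m)"
  have "\<pi> j v \<in> W j \<and> real (hamming m v (\<pi> j v)) < 1 / 4 ^ j * real m" if "v \<in> V" for j v
    using someI_ex[of "\<lambda>w. w \<in> W j \<and> real (hamming m v w) < 1 / 4 ^ j * real m"] near[OF that, of j]
    unfolding \<pi>_def by blast
  hence \<pi>: "\<And>j v. v \<in> V \<Longrightarrow> \<pi> j v \<in> W j"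
    and \<pi>_near: "\<And>j v. v \<in> V \<Longrightarrow> real (hamming m v (\<pi> j v)) < 1 / 4 ^ j * real m"
    by blast+
  have finW: "finite (W j)" for j using W finV finite_subset by blast
  \<comment> \<open>\<open>d v\<close> is \<open>v\<close> itself at the coarsest level and the
    difference to a coarser net point at all others.\<close>
  have link: "real (card {\<sigma> \<in> ?S. \<exists>v\<in>W j. \<tau> * ((real j + 1) / 2 ^ j) * real m < ip \<sigma> (d v)})
      \<le> 2 ^ m * (\<delta> / 2 ^ (j + 1))"
    if d: "\<And>v. v \<in> W j \<Longrightarrow> (\<Sum>i<m. (d v i)\<^sup>2) \<le> 16 * real m / 4 ^ j" for j d
  proof -
    let ?t = "\<tau> * ((real j + 1) / 2 ^ j) * real m"
    have "real (card {\<sigma> \<in> ?S. \<exists>v\<in>W j. ?t < ip \<sigma> (d v)})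
        \<le> real (card (\<Union>v\<in>W j. {\<sigma> \<in> ?S. ?t < ip \<sigma> (d v)}))"
      by (intro of_nat_mono card_mono) (use finW in auto)
    also have "\<dots> \<le> (\<Sum>v\<in>W j. real (card {\<sigma> \<in> ?S. ?t < ip \<sigma> (d v)}))"
      using card_UN_le[OF finW[of j], of "\<lambda>v. {\<sigma> \<in> ?S. ?t < ip \<sigma> (d v)}"]
      by (simp flip: of_nat_sum)
    also have "\<dots> \<le> (\<Sum>v\<in>W j. 2 ^ m * exp (- ?t\<^sup>2 / (2 * (16 * real m / 4 ^ j))))"
      unfolding ip_def
      by (intro sum_mono card_signed_sum_gt_le d) (use \<tau> m in auto)
    also have "- ?t\<^sup>2 / (2 * (16 * real m / 4 ^ j)) = - (real m * \<tau>\<^sup>2 / 32 * (real j + 1)\<^sup>2)"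
    proof -
      have "(4::real) ^ j = 2 ^ j * 2 ^ j" by (simp flip: power_mult_distrib)
      thus ?thesis using m by (simp add: power2_eq_square field_simps)
    qed
    also have "(\<Sum>v\<in>W j. 2 ^ m * exp (- (real m * \<tau>\<^sup>2 / 32 * (real j + 1)\<^sup>2)))
        \<le> exp (a * real (j + 1)) * (2 ^ m * exp (- (real m * \<tau>\<^sup>2 / 32 * (real j + 1)\<^sup>2)))"
      using pack[OF W(1,2), of j] by (simp add: mult_right_mono)
    also have "\<dots> = 2 ^ m * exp (a * (real j + 1) - real m * \<tau>\<^sup>2 / 32 * (real j + 1)\<^sup>2)"
      by (simp add: mult_exp_exp add.commute)
    also have "\<dots> \<le> 2 ^ m * exp (- ln (2 / \<delta>) * real (j + 1))"
    proof -
      have "real m * \<tau>\<^sup>2 / 32 * (real j + 1) \<le> real m * \<tau>\<^sup>2 / 32 * (real j + 1)\<^sup>2"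
        by (intro mult_left_mono) (auto simp: power2_eq_square)
      moreover have "(a + ln (2 / \<delta>)) * (real j + 1) \<le> real m * \<tau>\<^sup>2 / 32 * (real j + 1)"
        using large by (intro mult_right_mono) auto
      ultimately have "a * (real j + 1) - real m * \<tau>\<^sup>2 / 32 * (real j + 1)\<^sup>2
          \<le> - ln (2 / \<delta>) * real (j + 1)"
        by (simp add: algebra_simps)
      thus ?thesis by simp
    qed
    also have "exp (- ln (2 / \<delta>) * real (j + 1)) = (\<delta> / 2) ^ (j + 1)"
    proof -
      have "- ln (2 / \<delta>) = ln (\<delta> / 2)" using \<delta> by (simp add: ln_div)
      hence "exp (- ln (2 / \<delta>) * real (j + 1)) = exp (real (j + 1) * ln (\<delta> / 2))"
        by (simp add: mult.commute)
      also have "\<dots> = exp (ln (\<delta> / 2)) ^ (j + 1)" by (rule exp_of_nat_mult)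
      finally show ?thesis using \<delta> by simp
    qed
    also have "2 ^ m * (\<delta> / 2) ^ (j + 1) \<le> 2 ^ m * (\<delta> / 2 ^ (j + 1))"
      using \<delta> power_le_one[of \<delta> j] by (simp add: power_divide field_simps)
    finally show ?thesis .
  qed
  define T where "T = (\<lambda>J. \<Sum>j\<le>J. \<tau> * ((real j + 1) / 2 ^ j))"
  have chain: "real (card {\<sigma> \<in> ?S. \<exists>v\<in>W J. T J * real m < ip \<sigma> v})
      \<le> 2 ^ m * (\<Sum>j\<le>J. \<delta> / 2 ^ (j + 1))" for J
  proof (induction J)
    case 0
    have "(\<Sum>i<m. (v i)\<^sup>2) \<le> 16 * real m / 4 ^ 0" if "v \<in> W 0" for v
    proof -
      have "(\<Sum>i<m. (v i)\<^sup>2) \<le> (\<Sum>i<m. 1)"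
        using bdd that W by (intro sum_mono) (auto simp: abs_square_le_1 subset_iff)
      thus ?thesis by simp
    qed
    from link[of 0 "\<lambda>v. v", OF this] show ?case by (simp add: T_def)
  next
    case (Suc J)
    \<comment> \<open>The coarser point is chosen for the net point \<open>v\<close>, not for the
      vector finally approximated, so this level has only \<open>card (W (Suc J))\<close> links. The
      squared length is at most \<open>4 * m / 4^J\<close>, which is
      \<open>16 * m / 4^(J + 1)\<close>.\<close>
    let ?d = "\<lambda>v i. v i - \<pi> J v i"
    have sq: "(\<Sum>i<m. (?d v i)\<^sup>2) \<le> 16 * real m / 4 ^ Suc J" if v: "v \<in> W (Suc J)" for v
    proof -
      have vV: "v \<in> V" "\<pi> J v \<in> V" using v W \<pi> by blast+
      have "(\<Sum>i<m. (?d v i)\<^sup>2) \<le> (\<Sum>i<m. if v i \<noteq> \<pi> J v i then 4 else 0)"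
      proof (intro sum_mono)
        fix i assume "i \<in> {..<m}"
        hence "\<bar>?d v i\<bar> \<le> 2" using bdd[OF vV(1), of i] bdd[OF vV(2), of i] by auto
        hence "(?d v i)\<^sup>2 \<le> 2\<^sup>2" by (metis abs_le_square_iff abs_numeral)
        thus "(?d v i)\<^sup>2 \<le> (if v i \<noteq> \<pi> J v i then 4 else 0)" by simp
      qed
      also have "\<dots> = 4 * real (hamming m v (\<pi> J v))"
        by (simp add: hamming_def sum.If_cases Int_def conj_commute)
      also have "\<dots> \<le> 4 * (1 / 4 ^ J * real m)"
        using \<pi>_near[OF vV(1), of J] by simp
      finally show ?thesis by simp
    qed
    let ?A = "{\<sigma> \<in> ?S. \<exists>v\<in>W J. T J * real m < ip \<sigma> v}"
    let ?B = "{\<sigma> \<in> ?S. \<exists>v\<in>W (Suc J). \<tau> * ((real (Suc J) + 1) / 2 ^ Suc J) * real m < ip \<sigma> (?d v)}"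
    have "{\<sigma> \<in> ?S. \<exists>v\<in>W (Suc J). T (Suc J) * real m < ip \<sigma> v} \<subseteq> ?A \<union> ?B"
    proof
      fix \<sigma> assume "\<sigma> \<in> {\<sigma> \<in> ?S. \<exists>v\<in>W (Suc J). T (Suc J) * real m < ip \<sigma> v}"
      then obtain v where v: "\<sigma> \<in> ?S" "v \<in> W (Suc J)" "T (Suc J) * real m < ip \<sigma> v" by auto
      have "ip \<sigma> v = ip \<sigma> (\<pi> J v) + ip \<sigma> (?d v)"
        by (simp add: ip_def algebra_simps sum_subtractf)
      moreover have "T (Suc J) * real m
          = T J * real m + \<tau> * ((real (Suc J) + 1) / 2 ^ Suc J) * real m"
        by (simp add: T_def algebra_simps)
      ultimately have "T J * real m < ip \<sigma> (\<pi> J v) \<or>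
          \<tau> * ((real (Suc J) + 1) / 2 ^ Suc J) * real m < ip \<sigma> (?d v)"
        using v(3) by linarith
      moreover have "\<pi> J v \<in> W J" using v(2) W \<pi> by blast
      ultimately show "\<sigma> \<in> ?A \<union> ?B" using v by blast
    qed
    hence "card {\<sigma> \<in> ?S. \<exists>v\<in>W (Suc J). T (Suc J) * real m < ip \<sigma> v} \<le> card (?A \<union> ?B)"
      by (intro card_mono) auto
    also have "\<dots> \<le> card ?A + card ?B" by (rule card_Un_le)
    finally have "real (card {\<sigma> \<in> ?S. \<exists>v\<in>W (Suc J). T (Suc J) * real m < ip \<sigma> v})
        \<le> real (card ?A) + real (card ?B)" by (simp flip: of_nat_add)
    also have "\<dots> \<le> 2 ^ m * (\<Sum>j\<le>J. \<delta> / 2 ^ (j + 1)) + 2 ^ m * (\<delta> / 2 ^ (Suc J + 1))"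
      using Suc.IH link[of "Suc J" ?d, OF sq] by (intro add_mono) auto
    also have "\<dots> = 2 ^ m * (\<Sum>j\<le>Suc J. \<delta> / 2 ^ (j + 1))"
      by (simp add: algebra_simps)
    finally show ?case .
  qed
  have "{\<sigma> \<in> ?S. \<exists>v\<in>V. 4 * \<tau> * real m < (\<Sum>i<m. \<sigma> i * v i)}
      \<subseteq> {\<sigma> \<in> ?S. \<exists>v\<in>W m. T m * real m < ip \<sigma> v}"
  proof
    fix \<sigma> assume "\<sigma> \<in> {\<sigma> \<in> ?S. \<exists>v\<in>V. 4 * \<tau> * real m < (\<Sum>i<m. \<sigma> i * v i)}"
    then obtain v where v: "\<sigma> \<in> ?S" "v \<in> V" "4 * \<tau> * real m < ip \<sigma> v" by (auto simp: ip_def)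
    \<comment> \<open>At level \<open>m\<close> the radius is below 1, so the net point agrees with
      \<open>v\<close> on all \<open>m\<close> coordinates and the chain is complete.\<close>
    have "real m < 4 ^ m" using of_nat_less_two_power[of m, where 'a=real]
      power_mono[of 2 "4::real" m] by linarith
    hence "1 / 4 ^ m * real m < 1" by (simp add: divide_less_eq)
    hence "real (hamming m v (\<pi> m v)) < 1"
      using \<pi>_near[OF v(2), of m] by linarith
    hence "hamming m v (\<pi> m v) = 0" by simp
    hence "{i \<in> {..<m}. v i \<noteq> \<pi> m v i} = {}"
      by (simp add: hamming_def)
    hence "ip \<sigma> (\<pi> m v) = ip \<sigma> v"
      unfolding ip_def by (intro sum.cong) auto
    moreover have "T m \<le> 4 * \<tau>"
    proof -
      have "T m = \<tau> * (4 - (real m + 3) / 2 ^ m)"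
        unfolding T_def sum_distrib_left[symmetric] sum_chaining_weights ..
      also have "\<dots> \<le> \<tau> * 4" using \<tau> by (intro mult_left_mono) auto
      finally show ?thesis by simp
    qed
    hence "T m * real m \<le> 4 * \<tau> * real m" by (intro mult_right_mono) auto
    ultimately have "T m * real m < ip \<sigma> (\<pi> m v)" using v(3) by linarith
    thus "\<sigma> \<in> {\<sigma> \<in> ?S. \<exists>v\<in>W m. T m * real m < ip \<sigma> v}"
      using v(1) \<pi>[OF v(2), of m] by blast
  qed
  hence "real (card {\<sigma> \<in> ?S. \<exists>v\<in>V. 4 * \<tau> * real m < (\<Sum>i<m. \<sigma> i * v i)})
      \<le> real (card {\<sigma> \<in> ?S. \<exists>v\<in>W m. T m * real m < ip \<sigma> v})"
    by (intro of_nat_mono card_mono) auto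
  also note chain[of m]
  also have "(\<Sum>j\<le>m. \<delta> / 2 ^ (j + 1)) = \<delta> * (1 - 1 / 2 ^ (m + 1))"
  proof -
    have "(\<Sum>j\<le>n. \<delta> / 2 ^ (j + 1)) = \<delta> * (1 - 1 / 2 ^ (n + 1))" for n
      by (induction n) (auto simp: field_simps)
    thus ?thesis .
  qed
  also have "2 ^ m * (\<delta> * (1 - 1 / 2 ^ (m + 1))) \<le> 2 ^ m * \<delta>"
    using \<delta> by (simp add: mult_left_le)
  finally show ?thesis by simp
qed

section \<open>Uniform one-sided deviation bound\<close>

text \<open>Under the product measure the \<open>h (x i)\<close> are independent copies of
  \<open>h\<close> under \<open>D\<close>. The upper tail will serve for the near-optimal subsidy
  vector, the lower tail for the ghost sample.\<close>

lemma
  fixes h :: "'a \<Rightarrow> real" and \<epsilon> :: real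
  assumes D: "prob_space D" and h [measurable]: "h \<in> borel_measurable D"
    and range: "\<And>x. x \<in> space D \<Longrightarrow> h x \<in> {0..1}"
    and I: "finite I" "I \<noteq> {}" and \<epsilon>: "0 \<le> \<epsilon>"
  shows Hoeffding_PiM_ge: "measure (PiM I (\<lambda>_. D))
      {x \<in> space (PiM I (\<lambda>_. D)). (\<integral>y. h y \<partial>D) + \<epsilon> \<le> (\<Sum>i\<in>I. h (x i)) / card I}
      \<le> exp (- 2 * card I * \<epsilon>\<^sup>2)"
    and Hoeffding_PiM_le: "measure (PiM I (\<lambda>_. D))
      {x \<in> space (PiM I (\<lambda>_. D)). (\<Sum>i\<in>I. h (x i)) / card I \<le> (\<integral>y. h y \<partial>D) - \<epsilon>}
      \<le> exp (- 2 * card I * \<epsilon>\<^sup>2)"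
proof -
  interpret D: prob_space D by fact
  interpret P: prob_space "PiM I (\<lambda>_. D)" by (rule prob_space_PiM) (rule D)
  obtain i0 where i0: "i0 \<in> I" using I by auto
  have comp: "(\<lambda>x. x i) \<in> PiM I (\<lambda>_. D) \<rightarrow>\<^sub>M D" if "i \<in> I" for i
    using that by (rule measurable_component_singleton)
  have rv: "(\<lambda>x. h (x i)) \<in> borel_measurable (PiM I (\<lambda>_. D))" if "i \<in> I" for i
    by (rule measurable_compose[OF comp[OF that] h])
  have distr_h: "distr (PiM I (\<lambda>_. D)) borel (\<lambda>x. h (x i)) = distr D borel h" if "i \<in> I" for i
  proof -
    have "distr (PiM I (\<lambda>_. D)) borel (\<lambda>x. h (x i)) =
        distr (distr (PiM I (\<lambda>_. D)) D (\<lambda>x. x i)) borel h"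
      by (subst distr_distr) (auto simp: comp_def comp[OF that])
    thus ?thesis using distr_PiM_component[of I "\<lambda>_. D", OF D that] by simp
  qed
  have indep: "P.indep_vars (\<lambda>_. borel) (\<lambda>i x. h (x i)) I"
  proof (subst P.indep_vars_iff_distr_eq_PiM'[OF I(2)])
    have "distr (PiM I (\<lambda>_. D)) (PiM I (\<lambda>_. distr D borel h)) (compose I h)
        = PiM I (\<lambda>_. distr D (distr D borel h) h)"
      by (intro distr_PiM_finite_prob_space' I D D.prob_space_distr) auto
    moreover have "distr D (distr D borel h) h = distr D borel h"
      by (rule distr_cong) auto
    moreover have "distr (PiM I (\<lambda>_. D)) (PiM I (\<lambda>_. distr D borel h)) (compose I h)
        = distr (PiM I (\<lambda>_. D)) (PiM I (\<lambda>_. borel)) (\<lambda>x. \<lambda>i\<in>I. h (x i))"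
      by (rule distr_cong) (auto simp: compose_def cong: sets_PiM_cong)
    moreover have "PiM I (\<lambda>i. distr (PiM I (\<lambda>_. D)) borel (\<lambda>x. h (x i))) = PiM I (\<lambda>_. distr D borel h)"
      by (rule PiM_cong) (auto simp: distr_h)
    ultimately show "distr (PiM I (\<lambda>_. D)) (PiM I (\<lambda>_. borel)) (\<lambda>x. \<lambda>i\<in>I. h (x i))
        = PiM I (\<lambda>i. distr (PiM I (\<lambda>_. D)) borel (\<lambda>x. h (x i)))"
      by simp
  qed (rule rv)
  interpret H: Hoeffding_ineq_iid "PiM I (\<lambda>_. D)" I "\<lambda>i x. h (x i)" "\<lambda>x. h (x i0)" 0 1 "\<integral>y. h y \<partial>D"
  proof unfold_locales
    show "AE x in PiM I (\<lambda>_. D). h (x i0) \<in> {0..1}"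
      using i0 range by (intro AE_I2) (auto simp: space_PiM PiE_iff)
    have "(\<integral>y. h y \<partial>D) = (\<integral>y. y \<partial>(distr D borel h))" by (simp add: integral_distr)
    also have "\<dots> = (\<integral>y. y \<partial>(distr (PiM I (\<lambda>_. D)) borel (\<lambda>x. h (x i0))))"
      by (simp add: distr_h[OF i0])
    also have "\<dots> = (\<integral>x. h (x i0) \<partial>PiM I (\<lambda>_. D))"
      using rv[OF i0] by (simp add: integral_distr)
    finally show "(\<integral>y. h y \<partial>D) \<equiv> (\<integral>x. h (x i0) \<partial>PiM I (\<lambda>_. D))" by (rule eq_reflection)
  qed (use I indep rv[OF i0] in \<open>auto simp: distr_h i0\<close>)
  show "measure (PiM I (\<lambda>_. D))
      {x \<in> space (PiM I (\<lambda>_. D)). (\<integral>y. h y \<partial>D) + \<epsilon> \<le> (\<Sum>i\<in>I. h (x i)) / card I}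
      \<le> exp (- 2 * card I * \<epsilon>\<^sup>2)"
    using H.Hoeffding_ineq_ge'[OF \<epsilon> _ I(2)] by simp
  show "measure (PiM I (\<lambda>_. D))
      {x \<in> space (PiM I (\<lambda>_. D)). (\<Sum>i\<in>I. h (x i)) / card I \<le> (\<integral>y. h y \<partial>D) - \<epsilon>}
      \<le> exp (- 2 * card I * \<epsilon>\<^sup>2)"
    using H.Hoeffding_ineq_le'[OF \<epsilon> _ I(2)] by simp
qed

section \<open>Symmetrization for classes of polynomial growth\<close>

lemma countable_Bex_sets:
  assumes "countable Q" and "\<And>q. q \<in> Q \<Longrightarrow> {x \<in> space M. R q x} \<in> sets M"
  shows "{x \<in> space M. \<exists>q\<in>Q. R q x} \<in> sets M"
proof -
  have "{x \<in> space M. \<exists>q\<in>Q. R q x} = (\<Union>q\<in>Q. {x \<in> space M. R q x})" by auto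
  thus ?thesis using assms by (auto intro: sets.countable_UN'')
qed

text \<open>The growth assumption is a bound of Sauer type, with \<open>p\<close> as dimension, for
  real-valued functions. The points \<open>w j\<close> may repeat, as they do when coordinates are
  resampled. Finiteness is a separate assumption because \<open>card\<close> of an infinite set is
  0. Countability of \<open>Q\<close> keeps the deviation events measurable.\<close>

locale small_growth_class = prob_space D for D :: "'a measure" +
  fixes Q :: "'q set" and h :: "'q \<Rightarrow> 'a \<Rightarrow> real" and K p :: nat
  assumes countable_Q: "countable Q"
    and measurable_h: "q \<in> Q \<Longrightarrow> h q \<in> borel_measurable D"
    and h_range: "q \<in> Q \<Longrightarrow> x \<in> space D \<Longrightarrow> h q x \<in> {0..1}"
    and finite_growth: "1 \<le> (k::nat) \<Longrightarrow> finite ((\<lambda>q. \<lambda>j\<in>{..<k}. h q (w j)) ` Q)"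
    and card_growth: "1 \<le> (k::nat) \<Longrightarrow> card ((\<lambda>q. \<lambda>j\<in>{..<k}. h q (w j)) ` Q) \<le> (K * k) ^ p"
    and K: "2 \<le> K" and p: "1 \<le> p" "p \<le> K"
begin

lemma measurable_h_component:
  assumes "q \<in> Q" and "i \<in> I"
  shows "(\<lambda>z. h q (z i)) \<in> borel_measurable (PiM I (\<lambda>_. D))"
  by (rule measurable_compose[where N = D]) (use assms measurable_h in auto)

text \<open>The differences over \<open>k\<close> pairs are a function of the values at the
  \<open>2 * k\<close> underlying points; hence the factor 2.\<close>

lemma difference_traces:
  fixes y x :: "nat \<Rightarrow> 'a" and k :: nat
  assumes "1 \<le> k"
  shows "finite ((\<lambda>q. \<lambda>i\<in>{..<k}. h q (y i) - h q (x i)) ` Q)"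
    and "card ((\<lambda>q. \<lambda>i\<in>{..<k}. h q (y i) - h q (x i)) ` Q) \<le> (2 * K * k) ^ p"
proof -
  define w where "w = (\<lambda>j. if j < k then x j else y (j - k))"
  define F where "F = (\<lambda>u::nat \<Rightarrow> real. \<lambda>i\<in>{..<k}. u (i + k) - u i)"
  let ?G = "(\<lambda>q. \<lambda>j\<in>{..<2 * k}. h q (w j)) ` Q"
  have eq: "(\<lambda>q. \<lambda>i\<in>{..<k}. h q (y i) - h q (x i)) ` Q = F ` ?G"
    unfolding image_image by (intro image_cong refl) (auto simp: F_def w_def fun_eq_iff)
  have fin: "finite ?G" using assms by (intro finite_growth) auto
  show "finite ((\<lambda>q. \<lambda>i\<in>{..<k}. h q (y i) - h q (x i)) ` Q)"
    unfolding eq using fin by simp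
  have "card (F ` ?G) \<le> card ?G" using fin by (rule card_image_le)
  also have "\<dots> \<le> (K * (2 * k)) ^ p" using assms by (intro card_growth) auto
  finally show "card ((\<lambda>q. \<lambda>i\<in>{..<k}. h q (y i) - h q (x i)) ` Q) \<le> (2 * K * k) ^ p"
    unfolding eq by (simp add: mult_ac)
qed

lemma card_bad_signs_le:
  fixes \<delta> \<eta> :: real
  assumes m: "0 < m" and \<delta>: "0 < \<delta>" "\<delta> \<le> 1" and \<eta>: "0 < \<eta>"
    and large: "12 * (real p * ln (real K)) + ln (2 / \<delta>) \<le> real m * \<eta>\<^sup>2 / 2048"
    and x: "\<And>i::nat. i < m \<Longrightarrow> x i \<in> space D" and y: "\<And>i. i < m \<Longrightarrow> y i \<in> space D"
  shows "real (card {\<sigma> \<in> {..<m} \<rightarrow>\<^sub>E {-1, 1::real}.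
      \<exists>q\<in>Q. \<eta> / 2 * real m < (\<Sum>i<m. \<sigma> i * (h q (y i) - h q (x i)))}) \<le> 2 ^ m * \<delta>"
proof -
  define V where "V = (\<lambda>q. \<lambda>i\<in>{..<m}. h q (y i) - h q (x i)) ` Q"
  have finV: "finite V"
    unfolding V_def using m by (intro difference_traces) auto
  have pack: "real (card W) \<le> exp (12 * (real p * ln (real K)) * real (j + 1))"
    if W: "W \<subseteq> V" and sep: "separated m (1 / 4 ^ j) W" for j W
  proof (rule card_separated_le[OF _ sep m K p])
    show "finite W" using W finV finite_subset by blast
    fix k :: nat and \<iota> assume k: "1 \<le> k" and \<iota>: "\<iota> \<in> {..<k} \<rightarrow>\<^sub>E {..<m}"
    have "(\<lambda>v. \<lambda>i\<in>{..<k}. v (\<iota> i)) ` V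
        = (\<lambda>q. \<lambda>i\<in>{..<k}. h q (y (\<iota> i)) - h q (x (\<iota> i))) ` Q"
      unfolding V_def image_image using \<iota>
      by (intro image_cong refl) (auto simp: fun_eq_iff PiE_iff)
    hence "card ((\<lambda>v. \<lambda>i\<in>{..<k}. v (\<iota> i)) ` V) \<le> (2 * K * k) ^ p"
      using difference_traces(2)[OF k, of "\<lambda>i. y (\<iota> i)" "\<lambda>i. x (\<iota> i)"] by simp
    moreover have "card ((\<lambda>v. \<lambda>i\<in>{..<k}. v (\<iota> i)) ` W) \<le> card ((\<lambda>v. \<lambda>i\<in>{..<k}. v (\<iota> i)) ` V)"
      using W finV by (intro card_mono image_mono) auto
    ultimately show "card ((\<lambda>v. \<lambda>i\<in>{..<k}. v (\<iota> i)) ` W) \<le> (2 * K * k) ^ p" by linarith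
  qed
  \<comment> \<open>With \<open>\<tau> = \<eta> / 8\<close> the total allowance
    \<open>4 * \<tau>\<close> is \<open>\<eta> / 2\<close>, and \<open>\<tau>^2 / 32\<close> is
    \<open>\<eta>^2 / 2048\<close>.\<close>
  have "real (card {\<sigma> \<in> {..<m} \<rightarrow>\<^sub>E {-1, 1::real}.
      \<exists>v\<in>V. 4 * (\<eta> / 8) * real m < (\<Sum>i<m. \<sigma> i * v i)}) \<le> 2 ^ m * \<delta>"
  proof (rule card_sign_chaining_le[OF finV m _ pack \<delta>])
    fix v i assume "v \<in> V" "i < m"
    then obtain q where q: "q \<in> Q" "v i = h q (y i) - h q (x i)"
      by (auto simp: V_def)
    thus "\<bar>v i\<bar> \<le> 1"
      using h_range[OF q(1) x[OF \<open>i < m\<close>]] h_range[OF q(1) y[OF \<open>i < m\<close>]] by auto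
  qed (use \<eta> large in \<open>auto simp: power_divide\<close>)
  moreover have "(\<exists>v\<in>V. 4 * (\<eta> / 8) * real m < (\<Sum>i<m. \<sigma> i * v i)) \<longleftrightarrow>
      (\<exists>q\<in>Q. \<eta> / 2 * real m < (\<Sum>i<m. \<sigma> i * (h q (y i) - h q (x i))))" for \<sigma>
    by (simp add: V_def)
  ultimately show ?thesis by simp
qed

text \<open>Exchanging the entries \<open>i\<close> and \<open>i + m\<close> of the double sample
  preserves its distribution and flips the sign of one difference. Hence the event is equally likely
  for every sign vector, and averaging over the signs under the integral leaves a counting problem
  for a fixed double sample.\<close>

lemma ghost_deviation_le:
  fixes \<delta> \<eta> :: real
  assumes m: "0 < m" and \<delta>: "0 < \<delta>" "\<delta> \<le> 1" and \<eta>: "0 < \<eta>"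
    and large: "12 * (real p * ln (real K)) + ln (2 / \<delta>) \<le> real m * \<eta>\<^sup>2 / 2048"
  shows "measure (PiM {..<m + m} (\<lambda>_. D)) {z \<in> space (PiM {..<m + m} (\<lambda>_. D)).
      \<exists>q\<in>Q. \<eta> / 2 * real m < (\<Sum>i<m. h q (z (i + m)) - h q (z i))} \<le> \<delta>"
proof -
  let ?P = "PiM {..<m + m} (\<lambda>_. D)"
  let ?S = "{..<m} \<rightarrow>\<^sub>E {-1, 1::real}"
  interpret P: prob_space ?P by (rule prob_space_PiM) (rule prob_space_axioms)
  define A where "A = (\<lambda>\<sigma>::nat \<Rightarrow> real. {z \<in> space ?P.
      \<exists>q\<in>Q. \<eta> / 2 * real m < (\<Sum>i<m. \<sigma> i * (h q (z (i + m)) - h q (z i)))})"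
  have A_sets: "A \<sigma> \<in> sets ?P" for \<sigma>
    unfolding A_def
  proof (rule countable_Bex_sets[OF countable_Q])
    fix q assume q: "q \<in> Q"
    have "(\<lambda>z. \<Sum>i<m. \<sigma> i * (h q (z (i + m)) - h q (z i))) \<in> borel_measurable ?P"
      by (intro borel_measurable_sum borel_measurable_times borel_measurable_diff
          borel_measurable_const measurable_h_component q) auto
    thus "{z \<in> space ?P. \<eta> / 2 * real m < (\<Sum>i<m. \<sigma> i * (h q (z (i + m)) - h q (z i)))} \<in> sets ?P"
      by measurable
  qed
  have swap: "measure ?P (A \<sigma>) = measure ?P (A (\<lambda>_. 1))" if \<sigma>: "\<sigma> \<in> ?S" for \<sigma>
  proof -
    define t where "t = (\<lambda>i. if i < m then (if \<sigma> i = 1 then i else i + m)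
      else (if \<sigma> (i - m) = 1 then i else i - m))"
    have t_inj: "inj_on t {..<m + m}"
      by (auto simp: inj_on_def t_def split: if_splits)
    have t_ran: "t \<in> {..<m + m} \<rightarrow> {..<m + m}"
      by (auto simp: t_def)
    let ?T = "\<lambda>\<omega>. \<lambda>n\<in>{..<m + m}. \<omega> (t n)"
    have T: "distr ?P ?P ?T = ?P"
      by (rule distr_PiM_reindex[of "{..<m + m}" "\<lambda>_. D" t "{..<m + m}", OF prob_space_axioms t_inj t_ran])
    have T_meas: "?T \<in> ?P \<rightarrow>\<^sub>M ?P"
      using t_ran by (intro measurable_restrict measurable_component_singleton) auto
    have "measure ?P (A (\<lambda>_. 1)) = measure (distr ?P ?P ?T) (A (\<lambda>_. 1))"
      by (simp add: T)
    also have "\<dots> = measure ?P (?T -` A (\<lambda>_. 1) \<inter> space ?P)"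
      by (rule measure_distr[OF T_meas A_sets])
    also have "?T -` A (\<lambda>_. 1) \<inter> space ?P = A \<sigma>"
    proof -
      have "1 * (h q (?T z (i + m)) - h q (?T z i)) = \<sigma> i * (h q (z (i + m)) - h q (z i))"
        if "i < m" for q z i
      proof -
        have "\<sigma> i = 1 \<or> \<sigma> i = -1" using \<sigma> that by (auto simp: PiE_iff)
        thus ?thesis using that by (auto simp: t_def)
      qed
      hence sums: "(\<Sum>i<m. 1 * (h q (?T z (i + m)) - h q (?T z i)))
          = (\<Sum>i<m. \<sigma> i * (h q (z (i + m)) - h q (z i)))" for q z
        by (intro sum.cong) auto
      have "?T z \<in> space ?P" if "z \<in> space ?P" for z
        using measurable_space[OF T_meas that] .
      thus ?thesis unfolding A_def vimage_def mem_Collect_eq sums by auto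
    qed
    finally show ?thesis by simp
  qed
  have "2 ^ m * measure ?P (A (\<lambda>_. 1)) = (\<Sum>\<sigma>\<in>?S. measure ?P (A (\<lambda>_. 1)))"
    by (simp add: card_sign_vectors)
  also have "\<dots> = (\<Sum>\<sigma>\<in>?S. measure ?P (A \<sigma>))"
    by (intro sum.cong refl) (simp add: swap)
  also have "\<dots> = (\<Sum>\<sigma>\<in>?S. \<integral>z. indicator (A \<sigma>) z \<partial>?P)"
    using A_sets by (intro sum.cong refl) (simp add: sets.sets_into_space Int_absorb2)
  also have "\<dots> = (\<integral>z. (\<Sum>\<sigma>\<in>?S. indicator (A \<sigma>) z) \<partial>?P)"
    by (rule Bochner_Integration.integral_sum[symmetric])
       (use A_sets in \<open>auto intro!: integrable_real_indicator simp: less_top[symmetric]\<close>)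
  also have "\<dots> \<le> (\<integral>z. 2 ^ m * \<delta> \<partial>?P)"
  proof (rule integral_mono)
    show "integrable ?P (\<lambda>z. \<Sum>\<sigma>\<in>?S. indicator (A \<sigma>) z :: real)"
      using A_sets by (intro Bochner_Integration.integrable_sum integrable_real_indicator)
        (auto simp: less_top[symmetric])
    fix z assume z: "z \<in> space ?P"
    have "(\<Sum>\<sigma>\<in>?S. indicator (A \<sigma>) z :: real) = real (card {\<sigma> \<in> ?S. z \<in> A \<sigma>})"
      by (simp add: indicator_def sum.If_cases Int_def)
    also have "{\<sigma> \<in> ?S. z \<in> A \<sigma>} = {\<sigma> \<in> ?S.
        \<exists>q\<in>Q. \<eta> / 2 * real m < (\<Sum>i<m. \<sigma> i * (h q (z (i + m)) - h q (z i)))}"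
      using z by (auto simp: A_def)
    also have "real (card \<dots>) \<le> 2 ^ m * \<delta>"
      using z by (intro card_bad_signs_le m \<delta> \<eta> large) (auto simp: space_PiM PiE_iff)
    finally show "(\<Sum>\<sigma>\<in>?S. indicator (A \<sigma>) z) \<le> 2 ^ m * \<delta>" .
  qed auto
  also have "\<dots> = 2 ^ m * \<delta>" by (simp add: P.prob_space)
  finally have "measure ?P (A (\<lambda>_. 1)) \<le> \<delta>" by simp
  thus ?thesis by (simp add: A_def)
qed

text \<open>For a bad sample \<open>x\<close>, a deviating \<open>q\<close> is fixed before the
  ghost sample is drawn. With probability at least one half the ghost average exceeds the mean minus
  \<open>\<eta> / 2\<close>, which puts the double sample into \<open>A\<close>. By Fubini,
  \<open>Bad\<close> is at most twice as likely as \<open>A\<close>.\<close>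

theorem uniform_deviation_le:
  fixes \<delta> \<eta> :: real
  assumes m: "0 < m" and \<delta>: "0 < \<delta>" "\<delta> \<le> 1" and \<eta>: "0 < \<eta>"
    and large: "12 * (real p * ln (real K)) + ln (2 / \<delta>) \<le> real m * \<eta>\<^sup>2 / 2048"
  defines "Bad \<equiv> {x \<in> space (PiM {..<m} (\<lambda>_. D)).
      \<exists>q\<in>Q. (\<Sum>i<m. h q (x i)) / m + \<eta> < (\<integral>g. h q g \<partial>D)}"
  shows "Bad \<in> sets (PiM {..<m} (\<lambda>_. D))"
    and "measure (PiM {..<m} (\<lambda>_. D)) Bad \<le> 2 * \<delta>"
proof -
  let ?I = "{..<m}" and ?J = "{m..<m + m}"
  let ?PI = "PiM ?I (\<lambda>_. D)" and ?PJ = "PiM ?J (\<lambda>_. D)" and ?P = "PiM {..<m + m} (\<lambda>_. D)"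
  interpret PI: prob_space ?PI by (rule prob_space_PiM) (rule prob_space_axioms)
  interpret PJ: prob_space ?PJ by (rule prob_space_PiM) (rule prob_space_axioms)
  interpret P: prob_space ?P by (rule prob_space_PiM) (rule prob_space_axioms)
  interpret S: product_sigma_finite "\<lambda>_. D"
    by unfold_locales
  show Bad: "Bad \<in> sets ?PI"
    unfolding Bad_def
  proof (rule countable_Bex_sets[OF countable_Q])
    fix q assume q: "q \<in> Q"
    have "(\<lambda>x. \<Sum>i<m. h q (x i)) \<in> borel_measurable ?PI"
      by (intro borel_measurable_sum measurable_h_component q) auto
    thus "{x \<in> space ?PI. (\<Sum>i<m. h q (x i)) / m + \<eta> < (\<integral>g. h q g \<partial>D)} \<in> sets ?PI"
      by measurable
  qed
  define A where "A = {z \<in> space ?P. \<exists>q\<in>Q. \<eta> / 2 * real m < (\<Sum>i<m. h q (z (i + m)) - h q (z i))}"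
  have A: "A \<in> sets ?P"
    unfolding A_def
  proof (rule countable_Bex_sets[OF countable_Q])
    fix q assume q: "q \<in> Q"
    have "(\<lambda>z. \<Sum>i<m. h q (z (i + m)) - h q (z i)) \<in> borel_measurable ?P"
      by (intro borel_measurable_sum borel_measurable_diff
          measurable_h_component q) auto
    thus "{z \<in> space ?P. \<eta> / 2 * real m < (\<Sum>i<m. h q (z (i + m)) - h q (z i))} \<in> sets ?P"
      by measurable
  qed
  have IJ: "?I \<union> ?J = {..<m + m}" "?I \<inter> ?J = {}" by auto
  have half: "1 / 2 \<le> measure ?PJ ((\<lambda>y. merge ?I ?J (x, y)) -` A \<inter> space ?PJ)" if x: "x \<in> Bad" for x
  proof -
    from x obtain q where q: "q \<in> Q" and xs: "x \<in> space ?PI"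
      and dev: "(\<Sum>i<m. h q (x i)) / m + \<eta> < (\<integral>g. h q g \<partial>D)"
      by (auto simp: Bad_def)
    let ?G = "{y \<in> space ?PJ. (\<Sum>i\<in>?J. h q (y i)) / card ?J \<le> (\<integral>g. h q g \<partial>D) - \<eta> / 2}"
    have "measure ?PJ ?G \<le> exp (- 2 * card ?J * (\<eta> / 2)\<^sup>2)"
      by (rule Hoeffding_PiM_le) (use q m \<eta> measurable_h h_range prob_space_axioms in auto)
    also have "\<dots> \<le> exp (- ln 2)"
    proof -
      have "ln 2 \<le> ln (2 / \<delta>)" using \<delta> by (simp add: field_simps)
      moreover have "0 \<le> real p * ln (real K)" using K by simp
      ultimately have "ln 2 \<le> real m * \<eta>\<^sup>2 / 2048" using large by linarith
      also have "\<dots> \<le> real m * \<eta>\<^sup>2 / 2" by simp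
      finally show ?thesis by (simp add: power_divide)
    qed
    also have "\<dots> = 1 / 2" by (simp add: exp_minus)
    finally have G: "measure ?PJ ?G \<le> 1 / 2" .
    have G_sets: "?G \<in> sets ?PJ"
    proof -
      have "(\<lambda>y. \<Sum>i\<in>?J. h q (y i)) \<in> borel_measurable ?PJ"
        by (intro borel_measurable_sum measurable_h_component q) auto
      thus ?thesis by measurable
    qed
    have "1 / 2 \<le> measure ?PJ (space ?PJ - ?G)"
      using G G_sets by (simp add: PJ.prob_compl)
    also have "\<dots> \<le> measure ?PJ ((\<lambda>y. merge ?I ?J (x, y)) -` A \<inter> space ?PJ)"
    proof (rule PJ.finite_measure_mono)
      show "space ?PJ - ?G \<subseteq> (\<lambda>y. merge ?I ?J (x, y)) -` A \<inter> space ?PJ"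
      proof
        fix y assume y: "y \<in> space ?PJ - ?G"
        let ?z = "merge ?I ?J (x, y)"
        have "?z \<in> space (PiM (?I \<union> ?J) (\<lambda>_. D))"
          using xs y measurable_space[OF measurable_merge[of ?I ?J "\<lambda>_. D"], of "(x, y)"]
          by (auto simp: space_pair_measure)
        hence zs: "?z \<in> space ?P" by (simp add: IJ)
        have "(\<Sum>i<m. h q (?z i)) = (\<Sum>i<m. h q (x i))"
          by (intro sum.cong) (auto simp: merge_def)
        moreover have "(\<Sum>i<m. h q (?z (i + m))) = (\<Sum>i\<in>?J. h q (y i))"
          by (rule sum.reindex_bij_witness[of _ "\<lambda>i. i - m" "\<lambda>i. i + m"]) (auto simp: merge_def)
        moreover have "(\<integral>g. h q g \<partial>D) - \<eta> / 2 < (\<Sum>i\<in>?J. h q (y i)) / m"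
          using y by auto
        hence "(\<Sum>i<m. h q (x i)) / m + \<eta> / 2 < (\<Sum>i\<in>?J. h q (y i)) / m"
          using dev by linarith
        hence "((\<Sum>i<m. h q (x i)) + \<eta> / 2 * m) / m < (\<Sum>i\<in>?J. h q (y i)) / m"
          using m by (simp add: add_divide_distrib)
        hence "(\<Sum>i<m. h q (x i)) + \<eta> / 2 * m < (\<Sum>i\<in>?J. h q (y i))"
          using m by (simp add: divide_less_cancel)
        ultimately have "\<eta> / 2 * real m < (\<Sum>i<m. h q (?z (i + m)) - h q (?z i))"
          by (simp add: sum_subtractf)
        thus "y \<in> (\<lambda>y. merge ?I ?J (x, y)) -` A \<inter> space ?PJ"
          using zs q y by (auto simp: A_def)
      qed
      have "(\<lambda>y. merge ?I ?J (x, y)) \<in> ?PJ \<rightarrow>\<^sub>M PiM (?I \<union> ?J) (\<lambda>_. D)"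
        by (rule measurable_compose[OF measurable_Pair1'[OF xs] measurable_merge])
      thus "(\<lambda>y. merge ?I ?J (x, y)) -` A \<inter> space ?PJ \<in> sets ?PJ"
        by (rule measurable_sets) (simp add: IJ A)
    qed
    finally show ?thesis .
  qed
  have "ennreal (1 / 2) * emeasure ?PI Bad = (\<integral>\<^sup>+x. ennreal (1 / 2) * indicator Bad x \<partial>?PI)"
    using Bad by (simp add: nn_integral_cmult_indicator)
  also have "\<dots> \<le> (\<integral>\<^sup>+x. emeasure ?PJ ((\<lambda>y. merge ?I ?J (x, y)) -` A \<inter> space ?PJ) \<partial>?PI)"
  proof (rule nn_integral_mono)
    fix x
    show "ennreal (1 / 2) * indicator Bad x \<le> emeasure ?PJ ((\<lambda>y. merge ?I ?J (x, y)) -` A \<inter> space ?PJ)"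
    proof (cases "x \<in> Bad")
      case True
      hence "ennreal (1 / 2) * indicator Bad x = ennreal (1 / 2)"
        by (simp only: indicator_simps mult_1_right)
      also have "\<dots> \<le> ennreal (measure ?PJ ((\<lambda>y. merge ?I ?J (x, y)) -` A \<inter> space ?PJ))"
        by (rule ennreal_leI[OF half[OF True]])
      finally show ?thesis by (simp only: PJ.emeasure_eq_measure)
    qed simp
  qed
  also have "\<dots> = emeasure (PiM (?I \<union> ?J) (\<lambda>_. D)) A"
    by (rule S.emeasure_fold_integral[symmetric]) (use A IJ in auto)
  also have "\<dots> = ennreal (measure ?P A)" by (simp add: IJ P.emeasure_eq_measure)
  also have "\<dots> \<le> ennreal \<delta>"
    unfolding A_def by (intro ennreal_leI ghost_deviation_le assms)
  finally have "1 / 2 * measure ?PI Bad \<le> \<delta>"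
    using \<delta> unfolding PI.emeasure_eq_measure
    by (subst (asm) ennreal_mult[symmetric]) simp_all
  thus "measure ?PI Bad \<le> 2 * \<delta>" by simp
qed

end

section \<open>Fair cost-sharing games\<close>

lemma finite_joint_actions: "finite Act \<Longrightarrow> finite (joint_actions N Act g)"
  unfolding joint_actions_def
  by (rule finite_subset[of _ "{0..<N} \<rightarrow>\<^sub>E Act"]) (auto intro: finite_PiE)

lemma is_NE_joint_actions: "is_NE N Act g cS s \<Longrightarrow> s \<in> joint_actions N Act g"
  by (simp add: is_NE_def)

lemma finite_NE: "finite Act \<Longrightarrow> finite {s. is_NE N Act g cS s}"
  by (rule finite_subset[OF _ finite_joint_actions[of Act N g]]) (auto simp: is_NE_def)

lemma sub_cost_plus_subs:
  "sub_cost N g cS s + subs N cS s = (\<Sum>i<N. snd g (s i) / real (card (users N s (s i))))"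
  by (simp add: sub_cost_def subs_def agent_cost_def diff_divide_distrib flip: sum.distrib)

lemma users_of_agent:
  assumes "i < N"
  shows "card (users N s (s i)) \<in> {1..N}"
proof -
  have "i \<in> users N s (s i)" using assms by (simp add: users_def)
  moreover have "finite (users N s (s i))" by (simp add: users_def)
  ultimately have "0 < card (users N s (s i))" by (auto simp: card_gt_0_iff)
  moreover have "card (users N s (s i)) \<le> card {0..<N}"
    by (intro card_mono) (auto simp: users_def)
  ultimately show ?thesis by simp
qed

text \<open>The users of an action together pay its cost once, and the subsidies cancel, so each
  action contributes at most \<open>H\<close>.\<close>

lemma social_cost_bounds:
  assumes "finite Act" and g: "valid_game N Act H g" and s: "s \<in> joint_actions N Act g"
  shows "sub_cost N g cS s + subs N cS s \<in> {0..real (card Act) * H}"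
proof -
  have sA: "s i \<in> Act" if "i < N" for i
    using s that by (auto simp: joint_actions_def PiE_iff)
  have c: "0 \<le> snd g a" "snd g a \<le> H" if "a \<in> Act" for a
    using g that by (auto simp: valid_game_def)
  have "(\<Sum>i<N. snd g (s i) / real (card (users N s (s i))))
      = (\<Sum>a\<in>Act. \<Sum>i\<in>{i \<in> {..<N}. s i = a}. snd g (s i) / real (card (users N s (s i))))"
    by (rule sum.group[symmetric]) (use assms(1) sA in auto)
  also have "\<dots> = (\<Sum>a\<in>Act. \<Sum>i\<in>users N s a. snd g a / real (card (users N s a)))"
    by (intro sum.cong) (auto simp: users_def)
  also have "\<dots> \<le> (\<Sum>a\<in>Act. H)"
  proof (intro sum_mono)
    fix a assume a: "a \<in> Act"
    show "(\<Sum>i\<in>users N s a. snd g a / real (card (users N s a))) \<le> H"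
      using c[OF a] by (cases "card (users N s a) = 0") auto
  qed
  also have "\<dots> = real (card Act) * H" by simp
  finally show ?thesis
    unfolding sub_cost_plus_subs using c sA by (auto intro!: sum_nonneg)
qed

lemma loss_prior_bounds:
  assumes "finite Act" and g: "valid_game N Act H g" and "0 \<le> H"
  shows "loss_prior N Act g cS \<in> {0..real (card Act) * H}"
proof (cases "{s. is_NE N Act g cS s} = {}")
  case True
  then show ?thesis using assms by (simp add: loss_prior_def)
next
  case False
  let ?M = "(\<lambda>s. sub_cost N g cS s + subs N cS s) ` {s. is_NE N Act g cS s}"
  have "Max ?M \<in> ?M"
    using False finite_NE[OF assms(1)] by (intro Max_in) auto
  then obtain s where "is_NE N Act g cS s" and "Max ?M = sub_cost N g cS s + subs N cS s"
    by blast
  thus ?thesis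
    using False social_cost_bounds[OF assms(1) g is_NE_joint_actions]
    unfolding loss_prior_def by (simp only: if_False)
qed

text \<open>The numbers of users are free parameters, so no joint action occurs: with all other
  arguments fixed this is one affine inequality in \<open>cS\<close>.\<close>

definition prefers :: "game \<Rightarrow> (nat \<Rightarrow> real) \<Rightarrow> nat \<Rightarrow> nat \<Rightarrow> nat \<Rightarrow> nat \<Rightarrow> bool" where
  "prefers g cS a b k l \<longleftrightarrow> (snd g a - cS a) / real k \<le> (snd g b - cS b) / real l"

lemma is_NE_iff_prefers:
  "is_NE N Act g cS s \<longleftrightarrow> s \<in> joint_actions N Act g \<and>
     (\<forall>i<N. \<forall>b\<in>Act. i \<in> fst g b \<longrightarrow>
        prefers g cS (s i) b (card (users N s (s i))) (card (users N (s(i := b)) b)))"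
  by (simp add: is_NE_def prefers_def agent_cost_def)

lemma loss_prior_cong_prefers:
  assumes "\<And>a b k l. a \<in> Act \<Longrightarrow> b \<in> Act \<Longrightarrow> k \<in> {1..N} \<Longrightarrow> l \<in> {1..N} \<Longrightarrow>
      prefers g cS a b k l = prefers g cS' a b k l"
  shows "loss_prior N Act g cS = loss_prior N Act g cS'"
proof -
  \<comment> \<open>After the deviation agent \<open>i\<close> itself uses \<open>b\<close>, so
    neither count is 0.\<close>
  have "prefers g cS (s i) b (card (users N s (s i))) (card (users N (s(i := b)) b)) =
      prefers g cS' (s i) b (card (users N s (s i))) (card (users N (s(i := b)) b))"
    if "s \<in> joint_actions N Act g" "i < N" "b \<in> Act" for s i b
    using that users_of_agent[of i N s] users_of_agent[of i N "s(i := b)"]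
    by (intro assms) (auto simp: joint_actions_def PiE_iff)
  hence "{s. is_NE N Act g cS s} = {s. is_NE N Act g cS' s}"
    unfolding is_NE_iff_prefers by blast
  thus ?thesis unfolding loss_prior_def sub_cost_plus_subs by (rule arg_cong)
qed

lemma card_image_factor_le:
  assumes "finite (f ` A)" and "\<And>x y. x \<in> A \<Longrightarrow> y \<in> A \<Longrightarrow> f x = f y \<Longrightarrow> g x = g y"
  shows "finite (g ` A)" and "card (g ` A) \<le> card (f ` A)"
proof -
  have "g x = g (inv_into A f (f x))" if "x \<in> A" for x
    by (rule assms(2)) (use that in \<open>auto intro: inv_into_into simp: f_inv_into_f\<close>)
  hence eq: "g ` A = (\<lambda>t. g (inv_into A f t)) ` f ` A"
    unfolding image_image by (rule image_cong[OF refl])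
  show "finite (g ` A)"
    unfolding eq by (intro finite_imageI assms(1))
  show "card (g ` A) \<le> card (f ` A)"
    unfolding eq by (rule card_image_le[OF assms(1)])
qed

lemma loss_prior_growth:
  fixes w :: "nat \<Rightarrow> game"
  assumes Act: "finite Act" "Act \<noteq> {}" and N: "1 \<le> N" and k: "1 \<le> k"
  shows "finite ((\<lambda>cS. \<lambda>j\<in>{..<k}. loss_prior N Act (w j) cS) ` Q)"
    and "card ((\<lambda>cS. \<lambda>j\<in>{..<k}. loss_prior N Act (w j) cS) ` Q)
      \<le> (2 * (card Act)\<^sup>2 * N\<^sup>2 * k) ^ card Act"
proof -
  define F where "F = {..<k} \<times> Act \<times> Act \<times> {1..N} \<times> {1..N}"
  define \<beta> where "\<beta> = (\<lambda>(j, x, y, k', l::nat). snd (w j) y / real l - snd (w j) x / real k')"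
  \<comment> \<open>For \<open>x = y\<close> both contributions enter the same coefficient.\<close>
  define \<alpha> where "\<alpha> = (\<lambda>(j::nat, x::nat, y, k', l) v.
    (if v = x then 1 / real k' else 0) - (if v = y then 1 / real l else 0))"
  define pat where "pat = (\<lambda>cS. {f \<in> F. 0 \<le> \<beta> f + (\<Sum>v\<in>Act. \<alpha> f v * cS v)})"
  have finF: "finite F" using Act by (simp add: F_def)
  have cardF: "card F = k * (card Act)\<^sup>2 * N\<^sup>2"
    by (simp add: F_def card_cartesian_product power2_eq_square)
  have pat_iff: "(j, x, y, k', l) \<in> pat cS \<longleftrightarrow> prefers (w j) cS x y k' l"
    if "j < k" "x \<in> Act" "y \<in> Act" "k' \<in> {1..N}" "l \<in> {1..N}" for j x y k' l cS
  proof -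
    have "(\<Sum>v\<in>Act. \<alpha> (j, x, y, k', l) v * cS v) = cS x / real k' - cS y / real l"
      using that Act(1)
      by (simp add: \<alpha>_def left_diff_distrib sum_subtractf if_distrib[of "\<lambda>c. c * _"] cong: if_cong)
    thus ?thesis
      using that by (auto simp: pat_def F_def \<beta>_def prefers_def diff_divide_distrib)
  qed
  have fin_range: "finite (range pat)"
    by (rule finite_subset[of _ "Pow F"]) (use finF in \<open>auto simp: pat_def\<close>)
  hence fin: "finite (pat ` Q)" by (rule finite_subset[rotated]) auto
  have factor: "(\<lambda>j\<in>{..<k}. loss_prior N Act (w j) cS) = (\<lambda>j\<in>{..<k}. loss_prior N Act (w j) cS')"
    if "pat cS = pat cS'" for cS cS'
  proof (intro restrict_ext loss_prior_cong_prefers)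
    fix j a b k' l
    assume "j \<in> {..<k}" "a \<in> Act" "b \<in> Act" "k' \<in> {1..N}" "l \<in> {1..N}"
    thus "prefers (w j) cS a b k' l = prefers (w j) cS' a b k' l"
      using pat_iff[of j a b k' l] that by auto
  qed
  show "finite ((\<lambda>cS. \<lambda>j\<in>{..<k}. loss_prior N Act (w j) cS) ` Q)"
    by (rule card_image_factor_le(1)[OF fin factor])
  have "card ((\<lambda>cS. \<lambda>j\<in>{..<k}. loss_prior N Act (w j) cS) ` Q) \<le> card (pat ` Q)"
    by (rule card_image_factor_le(2)[OF fin factor])
  also have "\<dots> \<le> card (range pat)"
    using fin_range by (intro card_mono) auto
  also have "\<dots> \<le> (card F + 1) ^ card Act"
    unfolding pat_def by (rule card_halfspace_patterns_le[OF finF Act(1)])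
  also have "\<dots> \<le> (2 * (card Act)\<^sup>2 * N\<^sup>2 * k) ^ card Act"
  proof (intro power_mono)
    \<comment> \<open>\<open>F\<close> is nonempty, so the factor 2 absorbs the \<open>+ 1\<close>
      of the pattern bound.\<close>
    have "0 < card Act" using Act by (simp add: card_gt_0_iff)
    hence "1 \<le> k * (card Act)\<^sup>2 * N\<^sup>2" using N k by simp
    thus "card F + 1 \<le> 2 * (card Act)\<^sup>2 * N\<^sup>2 * k" unfolding cardF by (simp add: mult_ac)
  qed auto
  finally show "card ((\<lambda>cS. \<lambda>j\<in>{..<k}. loss_prior N Act (w j) cS) ` Q)
      \<le> (2 * (card Act)\<^sup>2 * N\<^sup>2 * k) ^ card Act" .
qed

text \<open>
  The equilibrium conditions are non-strict, so in the limit equilibria can only appear, never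
  disappear: the loss is upper semicontinuous in the subsidies.
\<close>
lemma loss_prior_upper_semicontinuous:
  fixes q :: "nat \<Rightarrow> nat \<Rightarrow> real"
  assumes Act: "finite Act" and g: "valid_game N Act H g" and H: "0 \<le> H"
    and lim: "\<And>a. (\<lambda>n. q n a) \<longlonglongrightarrow> cS a"
  shows "\<forall>\<^sub>F n in sequentially. loss_prior N Act g (q n) \<le> loss_prior N Act g cS"
proof -
  have "\<forall>\<^sub>F n in sequentially. is_NE N Act g (q n) s \<longrightarrow> is_NE N Act g cS s"
    if s: "s \<in> joint_actions N Act g" for s
  proof (cases "is_NE N Act g cS s")
    case False
    then obtain i b where ib: "i < N" "b \<in> Act" "i \<in> fst g b"
      and lt: "agent_cost N g cS (s(i := b)) i < agent_cost N g cS s i"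
      using s by (auto simp: is_NE_def not_le)
    \<comment> \<open>A deviation that is strictly profitable at the limit remains so for all late
      members of the sequence.\<close>
    have conv: "(\<lambda>n. agent_cost N g (q n) t i) \<longlonglongrightarrow> agent_cost N g cS t i" for t
      unfolding agent_cost_def divide_inverse by (intro tendsto_intros lim)
    have "\<forall>\<^sub>F n in sequentially. agent_cost N g (q n) (s(i := b)) i < agent_cost N g (q n) s i"
      using order_tendstoD(1)[OF tendsto_diff[OF conv[of s] conv[of "s(i := b)"]], of 0] lt
      by simp
    thus ?thesis
    proof eventually_elim
      case (elim n)
      hence "\<not> is_NE N Act g (q n) s" using ib unfolding is_NE_def by (meson not_le)
      thus ?case by simp
    qed
  qed simp
  hence "\<forall>\<^sub>F n in sequentially. \<forall>s\<in>joint_actions N Act g. is_NE N Act g (q n) s \<longrightarrow> is_NE N Act g cS s"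
    by (intro eventually_ball_finite finite_joint_actions Act) auto
  thus ?thesis
  proof eventually_elim
    case (elim n)
    hence sub: "{s. is_NE N Act g (q n) s} \<subseteq> {s. is_NE N Act g cS s}"
      by (auto dest: is_NE_joint_actions)
    show ?case
    proof (cases "{s. is_NE N Act g (q n) s} = {}")
      \<comment> \<open>Without equilibria the loss is 0 by convention, and the loss at the limit is
        nonnegative.\<close>
      case True
      thus ?thesis using loss_prior_bounds[OF Act g H, of cS] by (simp add: loss_prior_def[of N Act g "q n"])
    next
      case False
      hence "{s. is_NE N Act g cS s} \<noteq> {}" using sub by auto
      moreover have "Max ((\<lambda>s. sub_cost N g (q n) s + subs N (q n) s) ` {s. is_NE N Act g (q n) s})
          \<le> Max ((\<lambda>s. sub_cost N g cS s + subs N cS s) ` {s. is_NE N Act g cS s})"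
        unfolding sub_cost_plus_subs
        using False sub finite_NE[OF Act] by (intro Max_mono image_mono) auto
      ultimately show ?thesis using False unfolding loss_prior_def by (simp only: if_False)
    qed
  qed
qed

text \<open>A deviation can only return to the same action, so every joint action is an equilibrium
  under any subsidies.\<close>

lemma loss_prior_single_action:
  assumes "card Act = 1"
  shows "loss_prior N Act g cS = loss_prior N Act g cS'"
proof -
  obtain a where a: "Act = {a}" using assms by (auto simp: card_1_singleton_iff)
  have "is_NE N Act g S s \<longleftrightarrow> s \<in> joint_actions N Act g" for S s
  proof
    assume s: "s \<in> joint_actions N Act g"
    hence "s(i := a) = s" if "i < N" for i
      using that by (auto simp: joint_actions_def a PiE_iff fun_eq_iff)
    thus "is_NE N Act g S s" using s by (auto simp: is_NE_def a)
  qed (rule is_NE_joint_actions)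
  hence "{s. is_NE N Act g cS s} = {s. is_NE N Act g cS' s}" by simp
  thus ?thesis unfolding loss_prior_def sub_cost_plus_subs by (rule arg_cong)
qed

lemma exp_loss_nonneg:
  assumes "finite Act" and "0 \<le> H" and "\<forall>g\<in>space D. valid_game N Act H g"
  shows "0 \<le> exp_loss N Act D cS"
  unfolding exp_loss_def using loss_prior_bounds[OF assms(1) _ assms(2)] assms(3)
  by (intro Bochner_Integration.integral_nonneg) auto

text \<open>
  Only the loss of each single subsidy vector is assumed measurable, so events quantifying over all
  of them need not be. Since the empirical loss is upper semicontinuous, a bound of the expected
  by the empirical loss extends to all vectors from a countable set over which the graph of the
  expected loss is dense.
\<close>
lemma countable_graph_dense_subset:
  fixes \<phi> :: "(nat \<Rightarrow> real) \<Rightarrow> real"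
  obtains Q where "countable Q" and "Q \<subseteq> X"
    and "\<And>S. S \<in> X \<Longrightarrow> \<exists>q. (\<forall>n::nat. q n \<in> Q) \<and> (\<forall>a. (\<lambda>n. q n a) \<longlonglongrightarrow> S a) \<and> (\<lambda>n. \<phi> (q n)) \<longlonglongrightarrow> \<phi> S"
proof -
  \<comment> \<open>Separability is applied to the graph because \<open>\<phi>\<close> need not be
    continuous: density in \<open>X\<close> alone would not make \<open>\<phi> (q n)\<close>
    converge.\<close>
  obtain T where T: "countable T" "T \<subseteq> (\<lambda>S. (S, \<phi> S)) ` X" "(\<lambda>S. (S, \<phi> S)) ` X \<subseteq> closure T"
    using separable[of "(\<lambda>S. (S, \<phi> S)) ` X"] .
  show ?thesis
  proof (rule that)
    show "countable (fst ` T)" using T by simp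
    show "fst ` T \<subseteq> X" using T by auto
    fix S assume "S \<in> X"
    hence "(S, \<phi> S) \<in> closure T" using T by auto
    then obtain z where z: "\<And>n. z n \<in> T" "z \<longlonglongrightarrow> (S, \<phi> S)"
      by (auto simp: closure_sequential)
    have "snd (z n) = \<phi> (fst (z n))" for n using z(1)[of n] T(2) by auto
    hence "(\<lambda>n. \<phi> (fst (z n))) \<longlonglongrightarrow> \<phi> S"
      using tendsto_snd[OF z(2)] by simp
    moreover have "(\<lambda>n. fst (z n) a) \<longlonglongrightarrow> S a" for a
    proof -
      have "(\<lambda>n. fst (z n)) \<longlonglongrightarrow> S" using tendsto_fst[OF z(2)] by simp
      thus ?thesis
        by (rule continuous_on_tendsto_compose[OF continuous_on_product_coordinates[of a]]) auto
    qed
    ultimately show "\<exists>q. (\<forall>n::nat. q n \<in> fst ` T) \<and> (\<forall>a. (\<lambda>n. q n a) \<longlonglongrightarrow> S a) \<and>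
        (\<lambda>n. \<phi> (q n)) \<longlonglongrightarrow> \<phi> S"
      using z(1) by (intro exI[of _ "\<lambda>n. fst (z n)"]) auto
  qed
qed

text \<open>Error budget: \<open>\<epsilon> / 2\<close> for the uniform deviation,
  \<open>\<epsilon> / 4\<close> for the empirical loss of a fixed \<open>S0\<close>, and
  \<open>\<epsilon> / 4\<close> for the gap between \<open>S0\<close> and the infimum, so that no
  minimizer of the expected loss is presupposed. Failure budget: \<open>\<delta> / 2\<close> for
  each of \<open>Bad\<close> and \<open>Bad0\<close>.\<close>

lemma erm_generalizes:
  fixes N :: nat and Act :: "nat set" and H \<epsilon> \<delta> :: real and D :: "game measure" and m :: nat
  assumes N: "1 \<le> N" and Act: "finite Act" "Act \<noteq> {}" and H: "0 < H" and \<epsilon>: "0 < \<epsilon>"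
    and \<delta>: "0 < \<delta>" "\<delta> < 1" and D: "prob_space D"
    and valid: "\<forall>g\<in>space D. valid_game N Act H g"
    and meas: "\<forall>cS\<in>subsidies Act H. (\<lambda>g. loss_prior N Act g cS) \<in> borel_measurable D"
    and two: "2 \<le> card Act * N"
    and large: "400000 * (real (card Act)^2 * H^2 / \<epsilon>^2) *
        (real (card Act) * ln (real (card Act) * real N) + ln (1 / \<delta>)) \<le> real m"
  shows "\<exists>E \<in> sets (PiM {..<m} (\<lambda>_. D)). measure (PiM {..<m} (\<lambda>_. D)) E \<ge> 1 - \<delta> \<and>
       (\<forall>x\<in>E. \<forall>S'\<in>subsidies Act H.
          (\<forall>S\<in>subsidies Act H. emp_loss N Act m x S' \<le> emp_loss N Act m x S) \<longrightarrow>
          exp_loss N Act D S' \<le> (INF S\<in>subsidies Act H. exp_loss N Act D S) + \<epsilon>)"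
proof -
  interpret D: prob_space D by (rule D)
  define n where "n = card Act"
  define B where "B = real n * H"
  define \<phi> where "\<phi> = exp_loss N Act D"
  define X where "X = subsidies Act H"
  define K where "K = 2 * n\<^sup>2 * N\<^sup>2"
  define h where "h = (\<lambda>cS g. loss_prior N Act g cS / B)"
  define \<eta> where "\<eta> = \<epsilon> / (2 * B)"
  define L where "L = real n * ln (real n * real N)"
  let ?P = "PiM {..<m} (\<lambda>_. D)"
  interpret P: prob_space ?P by (rule prob_space_PiM) (rule D)
  have n: "1 \<le> n" using Act by (simp add: n_def card_gt_0_iff Suc_le_eq)
  have B: "0 < B" using n H by (simp add: B_def)
  have \<eta>: "0 < \<eta>" using \<epsilon> B by (simp add: \<eta>_def)

  \<comment> \<open>Keeps the logarithm away from 0, so that additive constants can be charged to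
    \<open>L\<close>.\<close>
  have lnN: "ln 2 \<le> ln (real n * real N)"
  proof -
    have "2 \<le> real (n * N)" using two unfolding n_def by linarith
    thus ?thesis by simp
  qed
  have "0 < ln (2::real)" by simp
  hence lnN_pos: "0 < ln (real n * real N)" using lnN by linarith
  have L: "ln (real n * real N) \<le> L"
    using n lnN_pos by (simp add: L_def)
  have ln\<delta>: "0 < ln (1 / \<delta>)" using \<delta> by simp
  have "400000 * (B\<^sup>2 / \<epsilon>\<^sup>2) * (L + ln (1 / \<delta>)) \<le> real m"
    using large by (simp add: B_def L_def n_def power_mult_distrib)
  hence "400000 * (L + ln (1 / \<delta>)) \<le> real m * (\<epsilon>\<^sup>2 / B\<^sup>2)"
    using B \<epsilon> by (simp add: field_simps)
  also have "\<epsilon>\<^sup>2 / B\<^sup>2 = 4 * \<eta>\<^sup>2" by (simp add: \<eta>_def power_divide power_mult_distrib)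
  finally have m\<eta>: "100000 * (L + ln (1 / \<delta>)) \<le> real m * \<eta>\<^sup>2" by simp
  have m: "0 < m"
  proof (rule ccontr)
    assume "\<not> 0 < m"
    thus False using m\<eta> L lnN_pos ln\<delta> by simp
  qed
  have lnK: "real n * ln (real K) \<le> 3 * L"
  proof -
    have "real K = 2 * (real n * real N)\<^sup>2" by (simp add: K_def power_mult_distrib)
    hence "ln (real K) = ln 2 + 2 * ln (real n * real N)"
      using n N by (simp add: ln_mult ln_realpow)
    hence "ln (real K) \<le> 3 * ln (real n * real N)" using lnN by linarith
    hence "real n * ln (real K) \<le> real n * (3 * ln (real n * real N))"
      by (intro mult_left_mono) auto
    thus ?thesis by (simp add: L_def)
  qed
  have ln8: "ln 8 \<le> 3 * L"
  proof -
    have "ln 8 = 3 * ln (2::real)" using ln_realpow[of 2 3] by simp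
    thus ?thesis using lnN L by linarith
  qed
  \<comment> \<open>The 39 is \<open>12 * 3\<close> from \<open>lnK\<close> plus 3 from
    \<open>ln8\<close>. Since \<open>39 * 2048 < 100000\<close>, and
    \<open>\<eta> = \<epsilon> / (2 * B)\<close> costs a factor 4, the constant 400000 is
    enough.\<close>
  have large': "12 * (real n * ln (real K)) + ln (2 / (\<delta> / 4)) \<le> real m * \<eta>\<^sup>2 / 2048"
  proof -
    have "ln (2 / (\<delta> / 4)) = ln 8 + ln (1 / \<delta>)" using \<delta> by (simp add: ln_div)
    hence "12 * (real n * ln (real K)) + ln (2 / (\<delta> / 4)) \<le> 39 * L + ln (1 / \<delta>)"
      using lnK ln8 by linarith
    also have "39 * L + ln (1 / \<delta>) \<le> 100000 * (L + ln (1 / \<delta>)) / 2048"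
      using L lnN_pos ln\<delta> by simp
    also have "\<dots> \<le> real m * \<eta>\<^sup>2 / 2048"
      by (rule divide_right_mono[OF m\<eta>]) simp
    finally show ?thesis .
  qed

  have loss: "loss_prior N Act g cS \<in> {0..B}" if "g \<in> space D" for g cS
    using loss_prior_bounds[OF Act(1), of N H g cS] valid that H by (simp add: B_def n_def)
  have hm: "h S \<in> borel_measurable D" if "S \<in> X" for S
    using meas that unfolding h_def X_def by (intro borel_measurable_divide) auto
  have hr: "h S g \<in> {0..1}" if "g \<in> space D" for S g
    using loss[OF that, of S] B by (simp add: h_def)
  have int_h: "(\<integral>g. h S g \<partial>D) = \<phi> S / B" for S
    by (simp add: h_def \<phi>_def exp_loss_def)
  have emp_h: "(\<Sum>i<m. h S (x i)) / m = emp_loss N Act m x S / B" for S x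
    by (simp add: h_def emp_loss_def sum_divide_distrib[symmetric] mult.commute)

  obtain Q where Q: "countable Q" "Q \<subseteq> X"
    and dense: "\<And>S. S \<in> X \<Longrightarrow> \<exists>q. (\<forall>n::nat. q n \<in> Q) \<and> (\<forall>a. (\<lambda>n. q n a) \<longlonglongrightarrow> S a) \<and>
      (\<lambda>n. \<phi> (q n)) \<longlonglongrightarrow> \<phi> S"
    using countable_graph_dense_subset[of X \<phi>] by blast
  have scale: "(\<lambda>q. \<lambda>j\<in>{..<k}. h q (w j)) ` Q =
      (\<lambda>u. \<lambda>j\<in>{..<k}. u j / B) ` (\<lambda>q. \<lambda>j\<in>{..<k}. loss_prior N Act (w j) q) ` Q" for k :: nat and w
    unfolding image_image by (intro image_cong refl) (auto simp: h_def)
  interpret small_growth_class D Q h K n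
  proof unfold_locales
    fix k :: nat and w :: "nat \<Rightarrow> game" assume k: "1 \<le> k"
    note growth = loss_prior_growth[OF Act N k, where w = w and Q = Q]
    show "finite ((\<lambda>q. \<lambda>j\<in>{..<k}. h q (w j)) ` Q)"
      unfolding scale by (intro finite_imageI growth)
    have "card ((\<lambda>q. \<lambda>j\<in>{..<k}. h q (w j)) ` Q) \<le> card ((\<lambda>q. \<lambda>j\<in>{..<k}. loss_prior N Act (w j) q) ` Q)"
      unfolding scale by (rule card_image_le[OF growth(1)])
    thus "card ((\<lambda>q. \<lambda>j\<in>{..<k}. h q (w j)) ` Q) \<le> (K * k) ^ n"
      using growth(2) by (simp add: K_def n_def)
  next
    have "1 * 1 \<le> n\<^sup>2 * N\<^sup>2" using n N by (intro mult_mono) auto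
    thus "2 \<le> K" by (simp add: K_def)
    have "n * 1 \<le> n\<^sup>2 * N\<^sup>2" using n N by (intro mult_mono) (auto simp: power2_eq_square)
    thus "n \<le> K" by (simp add: K_def)
  qed (use Q hm hr n in auto)

  define Bad where "Bad = {x \<in> space ?P. \<exists>q\<in>Q. (\<Sum>i<m. h q (x i)) / m + \<eta> < (\<integral>g. h q g \<partial>D)}"
  have Bad_sets: "Bad \<in> sets ?P" and Bad_le: "measure ?P Bad \<le> 2 * (\<delta> / 4)"
    unfolding Bad_def
    by (rule uniform_deviation_le[OF m _ _ \<eta> large'], use \<delta> in simp, use \<delta> in simp)+

  have bdd: "bdd_below (\<phi> ` X)"
    unfolding \<phi>_def using exp_loss_nonneg[OF Act(1) _ valid] H by (intro bdd_belowI[of _ 0]) auto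
  have "(\<lambda>a\<in>Act. 0) \<in> X" using H by (auto simp: X_def subsidies_def)
  hence X: "X \<noteq> {}" by blast
  have "(INF S\<in>X. \<phi> S) < (INF S\<in>X. \<phi> S) + \<epsilon> / 4" using \<epsilon> by simp
  then obtain S0 where S0: "S0 \<in> X" "\<phi> S0 < (INF S\<in>X. \<phi> S) + \<epsilon> / 4"
    by (subst (asm) cINF_less_iff[OF X bdd]) blast
  define Bad0 where "Bad0 = {x \<in> space ?P. (\<integral>g. h S0 g \<partial>D) + \<eta> / 2 \<le> (\<Sum>i<m. h S0 (x i)) / m}"
  have "measure ?P Bad0 \<le> exp (- 2 * card {..<m} * (\<eta> / 2)\<^sup>2)"
    using Hoeffding_PiM_ge[OF D hm[OF S0(1)] hr, of "{..<m}" "\<eta> / 2"] m \<eta>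
    unfolding Bad0_def by (simp add: lessThan_empty_iff)
  also have "\<dots> \<le> exp (- ln (2 / \<delta>))"
  proof -
    have "ln (2 / \<delta>) = ln 2 + ln (1 / \<delta>)" using \<delta> by (simp add: ln_div)
    moreover have "ln 2 \<le> L" using lnN L by linarith
    ultimately have "ln (2 / \<delta>) \<le> L + ln (1 / \<delta>)" by simp
    also have "\<dots> \<le> 100000 * (L + ln (1 / \<delta>)) / 2" using L lnN_pos ln\<delta> by simp
    also have "\<dots> \<le> real m * \<eta>\<^sup>2 / 2" by (rule divide_right_mono[OF m\<eta>]) simp
    finally have "ln (2 / \<delta>) \<le> real m * \<eta>\<^sup>2 / 2" .
    thus ?thesis by (simp add: power_divide)
  qed
  also have "\<dots> = \<delta> / 2" using \<delta> by (simp add: exp_minus)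
  finally have Bad0_le: "measure ?P Bad0 \<le> \<delta> / 2" .
  have Bad0_sets: "Bad0 \<in> sets ?P"
  proof -
    have "(\<lambda>x. \<Sum>i<m. h S0 (x i)) \<in> borel_measurable ?P"
      by (intro borel_measurable_sum measurable_compose[OF _ hm[OF S0(1)]]) auto
    thus ?thesis unfolding Bad0_def by measurable
  qed
  define E where "E = space ?P - (Bad \<union> Bad0)"
  have "measure ?P (Bad \<union> Bad0) \<le> measure ?P Bad + measure ?P Bad0"
    using Bad_sets Bad0_sets by (rule measure_Un_le)
  hence "1 - \<delta> \<le> measure ?P E"
    unfolding E_def using Bad_sets Bad0_sets Bad_le Bad0_le by (subst P.prob_compl) auto
  moreover have "E \<in> sets ?P" using Bad_sets Bad0_sets by (auto simp: E_def)
  moreover have "\<phi> S' \<le> (INF S\<in>X. \<phi> S) + \<epsilon>"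
    if x: "x \<in> E" and S': "S' \<in> X"
      and erm: "\<And>S. S \<in> X \<Longrightarrow> emp_loss N Act m x S' \<le> emp_loss N Act m x S" for x S'
  proof -
    have xs: "x \<in> space ?P" using x by (simp add: E_def)
    have \<eta>B: "\<eta> * B = \<epsilon> / 2" using B by (simp add: \<eta>_def)
    have dev: "\<phi> q \<le> emp_loss N Act m x q + \<epsilon> / 2" if "q \<in> Q" for q
    proof -
      have "\<phi> q / B \<le> emp_loss N Act m x q / B + \<eta>"
        using x xs that by (auto simp: E_def Bad_def emp_h int_h not_less)
      thus ?thesis using B \<eta>B by (simp add: field_simps)
    qed
    have dev0: "emp_loss N Act m x S0 \<le> \<phi> S0 + \<epsilon> / 4"
    proof -
      have "emp_loss N Act m x S0 / B < \<phi> S0 / B + \<eta> / 2"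
        using x xs by (auto simp: E_def Bad0_def emp_h int_h not_le)
      thus ?thesis using B \<eta>B by (simp add: field_simps)
    qed
    obtain q where q: "\<And>k::nat. q k \<in> Q" "\<And>a. (\<lambda>k. q k a) \<longlonglongrightarrow> S' a"
      and lim: "(\<lambda>k. \<phi> (q k)) \<longlonglongrightarrow> \<phi> S'"
      using dense[OF S'] by blast
    \<comment> \<open>The sample contains finitely many games, so the semicontinuity bounds hold for
      all of them simultaneously from some index on.\<close>
    have "\<forall>\<^sub>F k in sequentially. \<forall>i\<in>{..<m}. loss_prior N Act (x i) (q k) \<le> loss_prior N Act (x i) S'"
    proof (intro eventually_ball_finite ballI)
      fix i assume "i \<in> {..<m}"
      hence "valid_game N Act H (x i)" using xs valid by (auto simp: space_PiM PiE_iff)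
      thus "\<forall>\<^sub>F k in sequentially. loss_prior N Act (x i) (q k) \<le> loss_prior N Act (x i) S'"
        by (rule loss_prior_upper_semicontinuous[OF Act(1)]) (use H q in auto)
    qed simp
    hence "\<forall>\<^sub>F k in sequentially. \<phi> (q k) \<le> emp_loss N Act m x S' + \<epsilon> / 2"
    proof eventually_elim
      case (elim k)
      hence "emp_loss N Act m x (q k) \<le> emp_loss N Act m x S'"
        unfolding emp_loss_def by (intro divide_right_mono sum_mono) auto
      thus ?case using dev[OF q(1)[of k]] by linarith
    qed
    hence "\<phi> S' \<le> emp_loss N Act m x S' + \<epsilon> / 2"
      by (rule tendsto_upperbound[OF lim]) simp
    thus ?thesis using erm[OF S0(1)] dev0 S0(2) by linarith
  qed
  ultimately show ?thesis unfolding \<phi>_def X_def by blast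
qed

theorem theorem12:
  shows "\<exists>C>0. \<forall>(N::nat) (Act::nat set) (H::real) (\<epsilon>::real) (\<delta>::real) (D::game measure) (m::nat).
    N \<ge> 1 \<longrightarrow> finite Act \<longrightarrow> Act \<noteq> {} \<longrightarrow> H > 0 \<longrightarrow> \<epsilon> > 0 \<longrightarrow> \<delta> > 0 \<longrightarrow>
    prob_space D \<longrightarrow>
    (\<forall>g\<in>space D. valid_game N Act H g) \<longrightarrow>
    (\<forall>cS\<in>subsidies Act H. (\<lambda>g. loss_prior N Act g cS) \<in> borel_measurable D) \<longrightarrow>
    real m \<ge> C * (real (card Act)^2 * H^2 / \<epsilon>^2) *
                 (real (card Act) * ln (real (card Act) * real N) + ln (1 / \<delta>)) \<longrightarrow>
    (\<exists>E \<in> sets (PiM {0..<m} (\<lambda>_. D)).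
       measure (PiM {0..<m} (\<lambda>_. D)) E \<ge> 1 - \<delta> \<and>
       (\<forall>x\<in>E. \<forall>S'\<in>subsidies Act H.
          (\<forall>S\<in>subsidies Act H. emp_loss N Act m x S' \<le> emp_loss N Act m x S) \<longrightarrow>
          exp_loss N Act D S' \<le> (INF S\<in>subsidies Act H. exp_loss N Act D S) + \<epsilon>))"
proof (intro exI[of _ 400000] conjI allI impI)
  fix N :: nat and Act :: "nat set" and H \<epsilon> \<delta> :: real and D :: "game measure" and m :: nat
  assume N: "N \<ge> 1" and Act: "finite Act" "Act \<noteq> {}" and H: "H > 0" and \<epsilon>: "\<epsilon> > 0" and \<delta>: "\<delta> > 0"
    and D: "prob_space D" and valid: "\<forall>g\<in>space D. valid_game N Act H g"
    and meas: "\<forall>cS\<in>subsidies Act H. (\<lambda>g. loss_prior N Act g cS) \<in> borel_measurable D"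
    and large: "real m \<ge> 400000 * (real (card Act)^2 * H^2 / \<epsilon>^2) *
      (real (card Act) * ln (real (card Act) * real N) + ln (1 / \<delta>))"
  let ?P = "PiM {0..<m} (\<lambda>_. D)"
  interpret P: prob_space ?P by (rule prob_space_PiM) (rule D)
  show "\<exists>E \<in> sets ?P. measure ?P E \<ge> 1 - \<delta> \<and>
       (\<forall>x\<in>E. \<forall>S'\<in>subsidies Act H.
          (\<forall>S\<in>subsidies Act H. emp_loss N Act m x S' \<le> emp_loss N Act m x S) \<longrightarrow>
          exp_loss N Act D S' \<le> (INF S\<in>subsidies Act H. exp_loss N Act D S) + \<epsilon>)"
  proof -
    consider "1 \<le> \<delta>" | "\<delta> < 1" "2 \<le> card Act * N" | "card Act = 1"
    proof -
      have "1 \<le> card Act" using Act by (simp add: Suc_le_eq card_gt_0_iff)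
      hence "2 * 1 \<le> card Act * N" if "card Act \<noteq> 1"
        using that N by (intro mult_mono) auto
      thus ?thesis using that by fastforce
    qed
    thus ?thesis
    proof cases
      case 1
      \<comment> \<open>The demanded probability \<open>1 - \<delta>\<close> is at most 0
        here.\<close>
      thus ?thesis by (intro bexI[of _ "{}"]) auto
    next
      case 2
      thus ?thesis
        using erm_generalizes[OF N Act H \<epsilon> \<delta> 2(1) D valid meas 2(2) large]
        by (simp add: atLeast0LessThan)
    next
      case 3
      \<comment> \<open>For a single agent the logarithmic term vanishes here, so this case is not covered by the
        general argument.\<close>
      have const: "exp_loss N Act D S = exp_loss N Act D S'" for S S'
        unfolding exp_loss_def by (simp add: loss_prior_single_action[OF 3, of N _ S S'])
      have "(\<lambda>a\<in>Act. 0) \<in> subsidies Act H" using H by (auto simp: subsidies_def)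
      hence ne: "subsidies Act H \<noteq> {}" by blast
      have INF: "(INF S\<in>subsidies Act H. exp_loss N Act D S) = exp_loss N Act D S'" for S'
      proof -
        have "(INF S\<in>subsidies Act H. exp_loss N Act D S) = (INF S\<in>subsidies Act H. exp_loss N Act D S')"
          by (rule arg_cong[where f = Inf], rule image_cong[OF refl const])
        thus ?thesis using ne by simp
      qed
      show ?thesis
      proof (intro bexI[of _ "space ?P"] conjI ballI impI)
        show "1 - \<delta> \<le> measure ?P (space ?P)" using \<delta> by (simp add: P.prob_space)
        show "exp_loss N Act D S' \<le> (INF S\<in>subsidies Act H. exp_loss N Act D S) + \<epsilon>" for S'
          using \<epsilon> unfolding INF[of S'] by simp
      qed simp
    qed
  qed
qed simp

end
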